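(* Let $L$ be an ordered finite abstract simplicial complex and $\mathscr{A}$ an abelian category. For an $\mathscr{A}$-valued cellular sheaf $F$ on $L$, define $F_L\in\mathrm{Cell}(\widehat{\mathcal{K}(L)},\mathscr{A})$ by $F_L([v_{i_0},\dots,v_{i_k}]_x):=F(\{v_{i_0},\dots,v_{i_k}\})$ (with the maps $F_L(y\lesssim y')$ given by the corresponding maps of $F$). Then $\mathcal{K}(L)_0$ is totally ordered (via the bijection $[v]_v\mapsto v$ onto the vertex set $L_0$), and the cellular sheaf cochain complex of $L$ with $F$-coefficients is the ordered cellular sheaf cochain complex of $\widehat{\mathcal{K}(L)}$ with $F_L$-coefficients: $$(C^k(L,F),\delta^k_F)=(C^k_{\mathrm{ord}}(\widehat{\mathcal{K}(L)},F_L),\delta^k_{F_L})\qquad\text{for all }k\in\mathbb{Z}_{\ge0},$$ where the summand indexed by a simplex $\{v_{i_0}<\cdots<v_{i_k}\}\in L_k$ corresponds to the summand indexed by $[v_{i_0},\dots,v_{i_k}]_x$.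
   Context: Simplicial complex side. $L$ is a finite abstract simplicial complex (nonempty simplices only) with a total order on its vertices; $L_k$ is its set of $k$-simplices, each written uniquely as $(v_0,\dots,v_k)$ with $v_0<\cdots<v_k$, and $L_0$ is identified with the vertex set. $L$ is a poset under inclusion and an $\mathscr{A}$-valued cellular sheaf on $L$ is a functor $F:L\to\mathscr{A}$. For $\tau=(v_0,\dots,v_{k+1})\in L_{k+1}$ let $d_l\tau$ be $\tau$ with $v_l$ removed. $C^k(L,F)=\bigoplus_{\sigma\in L_k}F(\sigma)$ with projections $\pi_\sigma$, and $\delta^k_F$ has $\tau$-component $\sum_{l=0}^{k+1}(-1)^lF(d_l\tau\subset\tau)\circ\pi_{d_l\tau}$. Symmetric simplicial sets. Let $[n]=\{0,\dots,n\}$; $!\Delta$ has objects $[n]$, $n\ge0$, and all functions as morphisms; a finite symmetric simplicial set is a functor $X:{!\Delta}^{\mathrm{op}}\to\mathbf{FinSet}$, $X_n=X([n])$, $\widehat{X}=\coprod_nX_n$ is preordered by: for $x\in X_m$, $y\in X_n$, $x\lesssim y$ iff $X(\mu)(y)=x$ for some $\mu:[m]\to[n]$. $\mathrm{Cell}(\widehat{X},\mathscr{A})$ consists of the functors $F:\widehat{X}\to\mathscr{A}$ such that $x\lesssim y$ and $y\lesssim x$ imply $F(x)=F(y)$ and $F(x\lesssim y)=F(y\lesssim x)=\mathrm{Id}$. Hypergraph side. A hypergraph is $H=(E(H),V(H),f_H)$ with $E(H),V(H)$ finite and $f_H$ a map from $E(H)$ to the nonempty, non-singleton subsets of $V(H)$;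 $\tilde f_H(e)=f_H(e)$ for $e\in E(H)$, $\tilde f_H(v)=\{v\}$ for $v\in V(H)$. $L$ is regarded as the hypergraph $(L\setminus L_0,L_0,\mathrm{Id}_{L\setminus L_0})$. $\mathcal{K}(H)_n$ is the quotient of the disjoint union over $x\in E(H)\coprod V(H)$ of the sets of $(n+1)$-tuples in $\tilde f_H(x)$ by the equivalence relation generated by identifying equal tuples in $\tilde f_H(x)$ and $\tilde f_H(x')$ whenever all entries lie in both sets; $[v_0,\dots,v_n]_x$ is the class of $(v_0,\dots,v_n)$, and $\mathcal{K}(H)(\mu)([v_0,\dots,v_n]_x)=[v_{\mu(0)},\dots,v_{\mu(m)}]_x$. Face maps $d_l$ delete the $l$-th entry. Ordered complex. For a Čech $X$ (i.e. $\psi_n:X_n\to\check{C}(X)_n$, sending a simplex to its tuple of vertices, is an isomorphism onto the Čech nerve $\check{C}(X)_n=\{(y_0,\dots,y_n)\in (X_0)^{n+1}\mid\bigcap_iU_{y_i}\ne\emptyset\}$, where $U_y=\{z\in\widehat{X}\mid z\gtrsim y\}$; this holds for $X=\mathcal{K}(L)$, where $\psi_n([v_0,\dots,v_n]_x)=([v_0]_x,\dots,[v_n]_x)$) with $X_0$ totally ordered, $C^k_{\mathrm{ord}}(\widehat{X},F)=\bigoplus_{(y_0<\cdots<y_k)\in\check{C}(X)_k}F(\psi_k^{-1}(y_0,\dots,y_k))$, with differential whose component at $z=\psi_{k+1}^{-1}(y_0<\cdots<y_{k+1})$ is $\sum_{l=0}^{k+1}(-1)^lF(d_l(z)\lesssim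 z)\circ\pi_{d_l(z)}$. *)

theory Defs
  imports "HOL-Algebra.Ring"
begin

section \<open>Categories and functors\<close>

record ('o, 'a) cat =
  Obj :: "'o set"
  Arr :: "'a set"
  Dom :: "'a \<Rightarrow> 'o"
  Cod :: "'a \<Rightarrow> 'o"
  Idt :: "'o \<Rightarrow> 'a"
  Cmp :: "'a \<Rightarrow> 'a \<Rightarrow> 'a"  (* Cmp C g f is g after f *)

definition Hom :: "('o, 'a, 'z) cat_scheme \<Rightarrow> 'o \<Rightarrow> 'o \<Rightarrow> 'a set" where
  "Hom C a b = {f \<in> Arr C. Dom C f = a \<and> Cod C f = b}"

locale category =
  fixes C :: "('o, 'a, 'z) cat_scheme"
  assumes dom_obj: "f \<in> Arr C \<Longrightarrow> Dom C f \<in> Obj C"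
    and cod_obj: "f \<in> Arr C \<Longrightarrow> Cod C f \<in> Obj C"
    and idt_hom: "a \<in> Obj C \<Longrightarrow> Idt C a \<in> Hom C a a"
    and cmp_hom: "\<lbrakk>f \<in> Hom C a b; g \<in> Hom C b c\<rbrakk> \<Longrightarrow> Cmp C g f \<in> Hom C a c"
    and cmp_idt: "f \<in> Hom C a b \<Longrightarrow> Cmp C f (Idt C a) = f"
    and idt_cmp: "f \<in> Hom C a b \<Longrightarrow> Cmp C (Idt C b) f = f"
    and cmp_assoc: "\<lbrakk>f \<in> Hom C a b; g \<in> Hom C b c; h \<in> Hom C c d\<rbrakk>
        \<Longrightarrow> Cmp C h (Cmp C g f) = Cmp C (Cmp C h g) f"

definition opposite :: "('o, 'a) cat \<Rightarrow> ('o, 'a) cat" where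
  "opposite C = \<lparr>Obj = Obj C, Arr = Arr C, Dom = Cod C, Cod = Dom C, Idt = Idt C,
     Cmp = (\<lambda>g f. Cmp C f g)\<rparr>"

record ('o, 'a, 'p, 'b) func =
  FObj :: "'o \<Rightarrow> 'p"
  FArr :: "'a \<Rightarrow> 'b"

(* The values of FObj and FArr outside Obj and Arr of the source category are irrelevant. *)
locale cat_functor = source: category C + target: category D
  for C :: "('o, 'a, 'y) cat_scheme" and D :: "('p, 'b, 'z) cat_scheme" +
  fixes F :: "('o, 'a, 'p, 'b) func"
  assumes fobj: "a \<in> Obj C \<Longrightarrow> FObj F a \<in> Obj D"
    and farr: "f \<in> Hom C a b \<Longrightarrow> FArr F f \<in> Hom D (FObj F a) (FObj F b)"
    and f_idt: "a \<in> Obj C \<Longrightarrow> FArr F (Idt C a) = Idt D (FObj F a)"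
    and f_cmp: "\<lbrakk>f \<in> Hom C a b; g \<in> Hom C b c\<rbrakk>
        \<Longrightarrow> FArr F (Cmp C g f) = Cmp D (FArr F g) (FArr F f)"

(* A preordered set as a category; the arrow for leq x y is the pair (x, y). *)
definition preorder_cat :: "'p set \<Rightarrow> ('p \<Rightarrow> 'p \<Rightarrow> bool) \<Rightarrow> ('p, 'p \<times> 'p) cat" where
  "preorder_cat P leq = \<lparr>Obj = P, Arr = {(x, y). x \<in> P \<and> y \<in> P \<and> leq x y},
     Dom = fst, Cod = snd, Idt = (\<lambda>x. (x, x)), Cmp = (\<lambda>g f. (fst f, snd g))\<rparr>"


section \<open>Abelian categories\<close>

record ('o, 'a) addcat = "('o, 'a) cat" +
  HAdd :: "'a \<Rightarrow> 'a \<Rightarrow> 'a"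
  HZero :: "'o \<Rightarrow> 'o \<Rightarrow> 'a"

(* Only the additive structure of this ring record is used
   (for a = b it is the endomorphism ring of a). *)
definition hom_group :: "('o, 'a) addcat \<Rightarrow> 'o \<Rightarrow> 'o \<Rightarrow> 'a ring" where
  "hom_group A a b = \<lparr>carrier = Hom A a b, mult = Cmp A, one = Idt A a,
     zero = HZero A a b, add = HAdd A\<rparr>"

locale preadditive_category = category A
  for A :: "('o, 'a) addcat" +
  assumes hom_abelian_group:
      "\<lbrakk>a \<in> Obj A; b \<in> Obj A\<rbrakk> \<Longrightarrow> abelian_group (hom_group A a b)"
    and cmp_add_left: "\<lbrakk>f \<in> Hom A a b; g \<in> Hom A b c; h \<in> Hom A b c\<rbrakk>
        \<Longrightarrow> Cmp A (HAdd A g h) f = HAdd A (Cmp A g f) (Cmp A h f)"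
    and cmp_add_right: "\<lbrakk>f \<in> Hom A a b; g \<in> Hom A a b; h \<in> Hom A b c\<rbrakk>
        \<Longrightarrow> Cmp A h (HAdd A f g) = HAdd A (Cmp A h f) (Cmp A h g)"

definition zero_object :: "('o, 'a, 'z) cat_scheme \<Rightarrow> 'o \<Rightarrow> bool" where
  "zero_object C z \<longleftrightarrow> z \<in> Obj C \<and>
     (\<forall>a \<in> Obj C. (\<exists>!f. f \<in> Hom C z a) \<and> (\<exists>!f. f \<in> Hom C a z))"

definition direct_sum ::
  "('o, 'a) addcat \<Rightarrow> 'i set \<Rightarrow> ('i \<Rightarrow> 'o) \<Rightarrow> 'o \<Rightarrow> ('i \<Rightarrow> 'a) \<Rightarrow> ('i \<Rightarrow> 'a) \<Rightarrow> bool" where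
  "direct_sum A I G P pr incl \<longleftrightarrow>
     finite I \<and> P \<in> Obj A \<and>
     (\<forall>i \<in> I. G i \<in> Obj A \<and> pr i \<in> Hom A P (G i) \<and> incl i \<in> Hom A (G i) P) \<and>
     (\<forall>i \<in> I. \<forall>j \<in> I. Cmp A (pr i) (incl j) = (if i = j then Idt A (G i) else HZero A (G j) (G i))) \<and>
     finsum (hom_group A P P) (\<lambda>i. Cmp A (incl i) (pr i)) I = Idt A P"

definition is_mono :: "('o, 'a, 'z) cat_scheme \<Rightarrow> 'a \<Rightarrow> bool" where
  "is_mono C f \<longleftrightarrow> f \<in> Arr C \<and>
     (\<forall>a. \<forall>g \<in> Hom C a (Dom C f). \<forall>h \<in> Hom C a (Dom C f). Cmp C f g = Cmp C f h \<longrightarrow> g = h)"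

definition is_epi :: "('o, 'a, 'z) cat_scheme \<Rightarrow> 'a \<Rightarrow> bool" where
  "is_epi C f \<longleftrightarrow> f \<in> Arr C \<and>
     (\<forall>b. \<forall>g \<in> Hom C (Cod C f) b. \<forall>h \<in> Hom C (Cod C f) b. Cmp C g f = Cmp C h f \<longrightarrow> g = h)"

definition is_kernel :: "('o, 'a) addcat \<Rightarrow> 'a \<Rightarrow> 'a \<Rightarrow> bool" where
  "is_kernel A f k \<longleftrightarrow> f \<in> Arr A \<and> k \<in> Arr A \<and> Cod A k = Dom A f \<and>
     Cmp A f k = HZero A (Dom A k) (Cod A f) \<and>
     (\<forall>a. \<forall>h \<in> Hom A a (Dom A f). Cmp A f h = HZero A a (Cod A f) \<longrightarrow>
        (\<exists>!u. u \<in> Hom A a (Dom A k) \<and> Cmp A k u = h))"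

definition is_cokernel :: "('o, 'a) addcat \<Rightarrow> 'a \<Rightarrow> 'a \<Rightarrow> bool" where
  "is_cokernel A f c \<longleftrightarrow> f \<in> Arr A \<and> c \<in> Arr A \<and> Dom A c = Cod A f \<and>
     Cmp A c f = HZero A (Dom A f) (Cod A c) \<and>
     (\<forall>b. \<forall>h \<in> Hom A (Cod A f) b. Cmp A h f = HZero A (Dom A f) b \<longrightarrow>
        (\<exists>!u. u \<in> Hom A (Cod A c) b \<and> Cmp A u c = h))"

locale abelian_category = preadditive_category A
  for A :: "('o, 'a) addcat" +
  assumes ex_zero_object: "\<exists>z. zero_object A z"
    and ex_binary_direct_sum: "\<lbrakk>a \<in> Obj A; b \<in> Obj A\<rbrakk>
        \<Longrightarrow> \<exists>P pr incl. direct_sum A (UNIV :: bool set) (\<lambda>i. if i then a else b) P pr incl"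
    and ex_kernel: "f \<in> Arr A \<Longrightarrow> \<exists>k. is_kernel A f k"
    and ex_cokernel: "f \<in> Arr A \<Longrightarrow> \<exists>c. is_cokernel A f c"
    and mono_is_kernel: "is_mono A f \<Longrightarrow> \<exists>g. is_kernel A g f"
    and epi_is_cokernel: "is_epi A f \<Longrightarrow> \<exists>g. is_cokernel A g f"

(* sum over l = 0, ..., n of (-1)^l (f l), in the group of arrows from a to b *)
definition alternating_sum ::
  "('o, 'a) addcat \<Rightarrow> 'o \<Rightarrow> 'o \<Rightarrow> nat \<Rightarrow> (nat \<Rightarrow> 'a) \<Rightarrow> 'a" where
  "alternating_sum A a b n f =
     finsum (hom_group A a b) (\<lambda>l. add_pow (hom_group A a b) ((- 1) ^ l :: int) (f l)) {..n}"

(* A cochain complex presented together with its decomposition into direct sums: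
   in degree k the object, the projections and injections of the summands, and the
   differential from degree k to degree k + 1. *)
record ('i, 'o, 'a) cochains =
  CObj :: "nat \<Rightarrow> 'o"
  CProj :: "nat \<Rightarrow> 'i \<Rightarrow> 'a"
  CInj :: "nat \<Rightarrow> 'i \<Rightarrow> 'a"
  CDiff :: "nat \<Rightarrow> 'a"

(* The same objects and the same differentials; the summand formerly labelled b k j
   is now labelled j. *)
definition relabel :: "(nat \<Rightarrow> 'j \<Rightarrow> 'i) \<Rightarrow> ('i, 'o, 'a) cochains \<Rightarrow> ('j, 'o, 'a) cochains" where
  "relabel b K = \<lparr>CObj = CObj K, CProj = (\<lambda>k j. CProj K k (b k j)),
     CInj = (\<lambda>k j. CInj K k (b k j)), CDiff = CDiff K\<rparr>"


section \<open>Ordered simplicial complexes and cellular sheaves\<close>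

definition finite_simplicial_complex :: "'v set set \<Rightarrow> bool" where
  "finite_simplicial_complex L \<longleftrightarrow> finite L \<and> (\<forall>s \<in> L. finite s \<and> s \<noteq> {}) \<and>
     (\<forall>s \<in> L. \<forall>t. t \<noteq> {} \<and> t \<subseteq> s \<longrightarrow> t \<in> L)"

definition simplices :: "'v set set \<Rightarrow> nat \<Rightarrow> 'v set set" where
  "simplices L k = {s \<in> L. card s = Suc k}"

definition vertices :: "'v set set \<Rightarrow> 'v set" where
  "vertices L = {v. {v} \<in> L}"

definition increasing :: "'v rel \<Rightarrow> 'v list \<Rightarrow> bool" where
  "increasing r vs \<longleftrightarrow> sorted_wrt (\<lambda>v w. (v, w) \<in> r \<and> v \<noteq> w) vs"

definition listing :: "'v rel \<Rightarrow> 'v set \<Rightarrow> 'v list" where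
  "listing r s = (THE vs. set vs = s \<and> increasing r vs)"

definition simplex_face :: "'v rel \<Rightarrow> nat \<Rightarrow> 'v set \<Rightarrow> 'v set" where
  "simplex_face r l s = s - {listing r s ! l}"

abbreviation cellular_sheaf ::
  "('o, 'a) addcat \<Rightarrow> 'v set set \<Rightarrow> ('v set, 'v set \<times> 'v set, 'o, 'a) func \<Rightarrow> bool" where
  "cellular_sheaf A L F \<equiv> cat_functor (preorder_cat L (\<subseteq>)) A F"

(* K is the cellular sheaf cochain complex of L with F-coefficients. Direct sums are only
   determined up to isomorphism, so K records which ones have been chosen; they determine
   the differential. *)
definition is_sheaf_cochains ::
  "('o, 'a) addcat \<Rightarrow> 'v set set \<Rightarrow> 'v rel \<Rightarrow> ('v set, 'v set \<times> 'v set, 'o, 'a) func \<Rightarrow>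
   ('v set, 'o, 'a) cochains \<Rightarrow> bool" where
  "is_sheaf_cochains A L r F K \<longleftrightarrow> (\<forall>k.
     direct_sum A (simplices L k) (FObj F) (CObj K k) (CProj K k) (CInj K k) \<and>
     CDiff K k \<in> Hom A (CObj K k) (CObj K (Suc k)) \<and>
     (\<forall>t \<in> simplices L (Suc k).
        Cmp A (CProj K (Suc k) t) (CDiff K k) =
        alternating_sum A (CObj K k) (FObj F t) (Suc k)
          (\<lambda>l. Cmp A (FArr F (simplex_face r l t, t)) (CProj K k (simplex_face r l t)))))"


section \<open>Symmetric simplicial sets\<close>

(* The category with objects [n] = {0, ..., n}, represented by n, and all functions;
   an arrow from [m] to [n] is a triple (m, n, mu). *)
definition bang_Delta :: "(nat, nat \<times> nat \<times> (nat \<Rightarrow> nat)) cat" where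
  "bang_Delta = \<lparr>Obj = UNIV, Arr = {(m, n, mu). mu \<in> {..m} \<rightarrow>\<^sub>E {..n}},
     Dom = fst, Cod = (\<lambda>f. fst (snd f)), Idt = (\<lambda>n. (n, n, \<lambda>i \<in> {..n}. i)),
     Cmp = (\<lambda>g f. (fst f, fst (snd g), compose {..fst f} (snd (snd g)) (snd (snd f))))\<rparr>"

definition fin_sets :: "('x set, 'x set \<times> 'x set \<times> ('x \<Rightarrow> 'x)) cat" where
  "fin_sets = \<lparr>Obj = {S. finite S}, Arr = {(S, T, f). finite S \<and> finite T \<and> f \<in> S \<rightarrow>\<^sub>E T},
     Dom = fst, Cod = (\<lambda>f. fst (snd f)), Idt = (\<lambda>S. (S, S, \<lambda>x \<in> S. x)),
     Cmp = (\<lambda>g f. (fst f, fst (snd g), compose (fst f) (snd (snd g)) (snd (snd f))))\<rparr>"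

type_synonym 'x sset =
  "(nat, nat \<times> nat \<times> (nat \<Rightarrow> nat), 'x set, 'x set \<times> 'x set \<times> ('x \<Rightarrow> 'x)) func"

abbreviation symmetric_sset :: "'x sset \<Rightarrow> bool" where
  "symmetric_sset X \<equiv> cat_functor (opposite bang_Delta) fin_sets X"

(* X(mu), a map from X_n to X_m, for mu from [m] to [n] *)
definition sact :: "'x sset \<Rightarrow> nat \<Rightarrow> nat \<Rightarrow> (nat \<Rightarrow> nat) \<Rightarrow> 'x \<Rightarrow> 'x" where
  "sact X m n mu = snd (snd (FArr X (m, n, mu)))"

definition hat :: "'x sset \<Rightarrow> (nat \<times> 'x) set" where
  "hat X = (SIGMA n : UNIV. FObj X n)"

definition hat_le :: "'x sset \<Rightarrow> nat \<times> 'x \<Rightarrow> nat \<times> 'x \<Rightarrow> bool" where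
  "hat_le X p q \<longleftrightarrow> (\<exists>mu \<in> {..fst p} \<rightarrow>\<^sub>E {..fst q}. sact X (fst p) (fst q) mu (snd q) = snd p)"

definition Cell ::
  "'x sset \<Rightarrow> ('o, 'a) addcat \<Rightarrow> (nat \<times> 'x, (nat \<times> 'x) \<times> (nat \<times> 'x), 'o, 'a) func set" where
  "Cell X A = {F. cat_functor (preorder_cat (hat X) (hat_le X)) A F \<and>
     (\<forall>p \<in> hat X. \<forall>q \<in> hat X. hat_le X p q \<and> hat_le X q p \<longrightarrow>
        FObj F p = FObj F q \<and> FArr F (p, q) = Idt A (FObj F p) \<and> FArr F (q, p) = Idt A (FObj F p))}"

definition upper_set :: "'x sset \<Rightarrow> 'x \<Rightarrow> (nat \<times> 'x) set" where
  "upper_set X y = {z \<in> hat X. hat_le X (0, y) z}"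

(* Tuples of length n + 1 are lists. *)
definition cech_nerve :: "'x sset \<Rightarrow> nat \<Rightarrow> 'x list set" where
  "cech_nerve X n = {ys. length ys = Suc n \<and> set ys \<subseteq> FObj X 0 \<and> (\<Inter>y \<in> set ys. upper_set X y) \<noteq> {}}"

definition vertex_tuple :: "'x sset \<Rightarrow> nat \<Rightarrow> 'x \<Rightarrow> 'x list" where
  "vertex_tuple X n x = map (\<lambda>i. sact X 0 n (\<lambda>j \<in> {..0}. i) x) [0..<Suc n]"

definition is_cech :: "'x sset \<Rightarrow> bool" where
  "is_cech X \<longleftrightarrow> symmetric_sset X \<and>
     (\<forall>n. bij_betw (vertex_tuple X n) (FObj X n) (cech_nerve X n))"

(* d_l from X_(n+1) to X_n *)
definition face :: "'x sset \<Rightarrow> nat \<Rightarrow> nat \<Rightarrow> 'x \<Rightarrow> 'x" where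
  "face X n l = sact X n (Suc n) (\<lambda>i \<in> {..n}. if i < l then i else Suc i)"

definition increasing_tuples :: "'x sset \<Rightarrow> 'x rel \<Rightarrow> nat \<Rightarrow> 'x list set" where
  "increasing_tuples X r k = {ys \<in> cech_nerve X k. increasing r ys}"

definition simplex_of_tuple :: "'x sset \<Rightarrow> nat \<Rightarrow> 'x list \<Rightarrow> 'x" where
  "simplex_of_tuple X k = the_inv_into (FObj X k) (vertex_tuple X k)"

(* K is the ordered cellular sheaf cochain complex of hat X with F-coefficients, where X is
   Cech and r is the total order on X_0; compare is_sheaf_cochains. *)
definition is_ordered_cochains ::
  "('o, 'a) addcat \<Rightarrow> 'x sset \<Rightarrow> 'x rel \<Rightarrow> (nat \<times> 'x, (nat \<times> 'x) \<times> (nat \<times> 'x), 'o, 'a) func \<Rightarrow>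
   ('x list, 'o, 'a) cochains \<Rightarrow> bool" where
  "is_ordered_cochains A X r F K \<longleftrightarrow> (\<forall>k.
     direct_sum A (increasing_tuples X r k) (\<lambda>ys. FObj F (k, simplex_of_tuple X k ys))
       (CObj K k) (CProj K k) (CInj K k) \<and>
     CDiff K k \<in> Hom A (CObj K k) (CObj K (Suc k)) \<and>
     (\<forall>ys \<in> increasing_tuples X r (Suc k).
        let z = simplex_of_tuple X (Suc k) ys in
        Cmp A (CProj K (Suc k) ys) (CDiff K k) =
        alternating_sum A (CObj K k) (FObj F (Suc k, z)) (Suc k)
          (\<lambda>l. Cmp A (FArr F ((k, face X k l z), (Suc k, z)))
                     (CProj K k (vertex_tuple X k (face X k l z))))))"


section \<open>The symmetric simplicial set of a hypergraph\<close>

record ('e, 'v) hypergraph =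
  edges :: "'e set"
  verts :: "'v set"
  ends :: "'e \<Rightarrow> 'v set"

definition is_hypergraph :: "('e, 'v) hypergraph \<Rightarrow> bool" where
  "is_hypergraph H \<longleftrightarrow> finite (edges H) \<and> finite (verts H) \<and>
     (\<forall>e \<in> edges H. ends H e \<subseteq> verts H \<and> ends H e \<noteq> {} \<and> (\<forall>v. ends H e \<noteq> {v}))"

definition hcells :: "('e, 'v) hypergraph \<Rightarrow> ('e + 'v) set" where
  "hcells H = edges H <+> verts H"

definition cell_verts :: "('e, 'v) hypergraph \<Rightarrow> 'e + 'v \<Rightarrow> 'v set" where
  "cell_verts H x = (case x of Inl e \<Rightarrow> ends H e | Inr v \<Rightarrow> {v})"

definition ktuples :: "('e, 'v) hypergraph \<Rightarrow> nat \<Rightarrow> (('e + 'v) \<times> 'v list) set" where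
  "ktuples H n = (SIGMA x : hcells H. {vs. length vs = Suc n \<and> set vs \<subseteq> cell_verts H x})"

definition generated_equiv :: "'b set \<Rightarrow> 'b rel \<Rightarrow> 'b rel" where
  "generated_equiv S R = (R \<union> R\<inverse>)\<^sup>* \<inter> S \<times> S"

definition kequiv :: "('e, 'v) hypergraph \<Rightarrow> nat \<Rightarrow> (('e + 'v) \<times> 'v list) rel" where
  "kequiv H n = generated_equiv (ktuples H n)
     {((x, vs), (x', vs)) | x x' vs. (x, vs) \<in> ktuples H n \<and> (x', vs) \<in> ktuples H n}"

definition kclass :: "('e, 'v) hypergraph \<Rightarrow> nat \<Rightarrow> 'e + 'v \<Rightarrow> 'v list \<Rightarrow> (('e + 'v) \<times> 'v list) set" where
  "kclass H n x vs = kequiv H n `` {(x, vs)}"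

definition Kset :: "('e, 'v) hypergraph \<Rightarrow> nat \<Rightarrow> (('e + 'v) \<times> 'v list) set set" where
  "Kset H n = ktuples H n // kequiv H n"

definition precompose :: "nat \<Rightarrow> (nat \<Rightarrow> nat) \<Rightarrow> 'v list \<Rightarrow> 'v list" where
  "precompose m mu vs = map (\<lambda>i. vs ! mu i) [0..<Suc m]"

(* The map induced on classes is written as the saturation of the image of a class;
   see Kcomplex_act below. *)
definition Kcomplex :: "('e, 'v) hypergraph \<Rightarrow> (('e + 'v) \<times> 'v list) set sset" where
  "Kcomplex H = \<lparr>FObj = Kset H,
     FArr = (\<lambda>(m, n, mu). (Kset H n, Kset H m,
       \<lambda>c \<in> Kset H n. kequiv H m `` (map_prod id (precompose m mu) ` c)))\<rparr>"

(* The vertex identified with the 0-simplex {v} is v. *)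
definition hypergraph_of :: "'v set set \<Rightarrow> ('v set, 'v) hypergraph" where
  "hypergraph_of L = \<lparr>edges = L - simplices L 0, verts = vertices L, ends = id\<rparr>"

abbreviation KL :: "'v set set \<Rightarrow> (('v set + 'v) \<times> 'v list) set sset" where
  "KL L \<equiv> Kcomplex (hypergraph_of L)"

(* The order on K(L)_0 that corresponds to r under [v]_v |-> v. *)
definition KL_order :: "'v set set \<Rightarrow> 'v rel \<Rightarrow> (('v set + 'v) \<times> 'v list) set rel" where
  "KL_order L r = {(kclass (hypergraph_of L) 0 (Inr v) [v], kclass (hypergraph_of L) 0 (Inr w) [w]) | v w.
     (v, w) \<in> r}"

(* All representatives of a class have the same tuple, hence the same set of entries. *)
definition entries :: "(('e + 'v) \<times> 'v list) set \<Rightarrow> 'v set" where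
  "entries c = (\<Union>(x, vs) \<in> c. set vs)"

definition sheaf_on_KL ::
  "('v set, 'v set \<times> 'v set, 'o, 'a) func \<Rightarrow>
   (nat \<times> (('v set + 'v) \<times> 'v list) set,
    (nat \<times> (('v set + 'v) \<times> 'v list) set) \<times> (nat \<times> (('v set + 'v) \<times> 'v list) set), 'o, 'a) func" where
  "sheaf_on_KL F = \<lparr>FObj = (\<lambda>p. FObj F (entries (snd p))),
     FArr = (\<lambda>(p, q). FArr F (entries (snd p), entries (snd q)))\<rparr>"

lemma kequiv_iff:
  "((x, vs), (x', vs')) \<in> kequiv H n \<longleftrightarrow>
     vs = vs' \<and> (x, vs) \<in> ktuples H n \<and> (x', vs') \<in> ktuples H n"
proof -
  let ?R = "{((x, vs), (x', vs)) | x x' vs. (x, vs) \<in> ktuples H n \<and> (x', vs) \<in> ktuples H n}"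
  have "snd p = snd q" if "(p, q) \<in> (?R \<union> ?R\<inverse>)\<^sup>*" for p q
    using that by (induction rule: rtrancl_induct) auto
  then show ?thesis
    unfolding kequiv_def generated_equiv_def
    by (auto intro!: r_into_rtrancl)
qed

lemma kclass_eq:
  assumes "(x, vs) \<in> ktuples H n"
  shows "kclass H n x vs = {(x', vs) | x'. (x', vs) \<in> ktuples H n}"
  using assms unfolding kclass_def by (auto simp: kequiv_iff)

lemma entries_kclass:
  assumes "(x, vs) \<in> ktuples H n"
  shows "entries (kclass H n x vs) = set vs"
  using assms by (auto simp: kclass_eq entries_def)

lemma sheaf_on_KL_kclass:
  assumes "(x, vs) \<in> ktuples (hypergraph_of L) n"
  shows "FObj (sheaf_on_KL F) (n, kclass (hypergraph_of L) n x vs) = FObj F (set vs)"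
  using assms by (simp add: sheaf_on_KL_def entries_kclass)

lemma precompose_ktuples:
  assumes "(x, vs) \<in> ktuples H n" "mu \<in> {..m} \<rightarrow>\<^sub>E {..n}"
  shows "(x, precompose m mu vs) \<in> ktuples H m"
proof -
  have "vs ! mu i \<in> cell_verts H x" if "i < Suc m" for i
  proof -
    have "mu i < length vs" using assms that by (auto simp: ktuples_def PiE_iff less_Suc_eq_le)
    then show ?thesis using assms(1) nth_mem by (force simp: ktuples_def)
  qed
  then show ?thesis using assms(1) by (auto simp: ktuples_def precompose_def simp del: upt_Suc)
qed

lemma Kcomplex_act:
  assumes "(x, vs) \<in> ktuples H n" "mu \<in> {..m} \<rightarrow>\<^sub>E {..n}"
  shows "sact (Kcomplex H) m n mu (kclass H n x vs) = kclass H m x (precompose m mu vs)"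
proof -
  have "kclass H n x vs \<in> Kset H n"
    using assms(1) by (auto simp: Kset_def kclass_def quotient_def)
  then have "sact (Kcomplex H) m n mu (kclass H n x vs)
      = kequiv H m `` (map_prod id (precompose m mu) ` kclass H n x vs)"
    by (simp add: sact_def Kcomplex_def)
  also have "map_prod id (precompose m mu) ` kclass H n x vs
      = {(x', precompose m mu vs) | x'. (x', vs) \<in> ktuples H n}"
    by (auto simp: kclass_eq[OF assms(1)] image_iff)
  also have "kequiv H m `` \<dots> = kclass H m x (precompose m mu vs)"
    unfolding kclass_eq[OF precompose_ktuples[OF assms]]
    using assms(1) precompose_ktuples[OF _ assms(2)]
    by (auto simp: kequiv_iff intro!: ImageI[of "(x, precompose m mu vs)"])
  finally show ?thesis .
qed

end

theory Submission
  imports Defs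
begin

text \<open>
  The summands of both complexes are values of \<open>F\<close> on simplices of \<open>L\<close>, so once the index sets are
  matched everything else is forced: the same objects, projections and injections form the direct
  sums, and the two formulas for the differential agree term by term.

  The matching of index sets rests on a concrete description of \<open>K(L)\<close>. A tuple of vertices lies in
  some cell of \<open>L\<close> exactly when its entries span a simplex, because \<open>L\<close> is closed under
  nonempty subsets, and the identification of equal tuples in different cells forgets the cell. Hence
  \<open>K(L)\<^sub>n\<close> is the set of \<open>(n+1)\<close>-tuples, with repetitions, that span a simplex
  (\<open>Kset_tuple_class\<close>), and the operators act by reindexing tuples (\<open>sact_tuple_class\<close>). In this
  description the preorder on simplices is inclusion of sets of entries (\<open>hat_le_iff\<close>), so \<open>F\<^sub>L\<close> is
  \<open>F\<close> pulled back along a monotone map; simplices with the same entries are the equivalent ones, and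
  \<open>F\<^sub>L\<close> gives them the same value. A family of vertices has a common upper bound exactly when it spans a
  simplex, so \<open>K(L)\<close> coincides with its Cech nerve (\<open>cech_nerve_KL\<close>, \<open>is_cech_KL\<close>).

  Listing the vertices of a simplex in increasing order is then a bijection from the \<open>k\<close>-simplices of
  \<open>L\<close> onto the increasing tuples of the nerve (\<open>bij_betw_ordered_tuple\<close>). Deleting the \<open>l\<close>-th entry
  of the listing lists the \<open>l\<close>-th face (\<open>face_listing\<close>), so the components of the two differentials
  are the same alternating sums (\<open>sheaf_cochains_iff_ordered_cochains\<close>).

  That the complex exists at all is a statement about the abelian category: finite direct sums
  exist (\<open>ex_direct_sum\<close>), and an arrow into one is given by its components (\<open>direct_sum_lift\<close>),
  which yields the differential.
\<close>

section \<open>Composition and finite sums\<close>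

context preadditive_category
begin

lemma HomD: "f \<in> Hom A a b \<Longrightarrow> a \<in> Obj A" "f \<in> Hom A a b \<Longrightarrow> b \<in> Obj A"
  using dom_obj cod_obj by (auto simp: Hom_def)

lemma hom_group_simps [simp]:
  "carrier (hom_group A a b) = Hom A a b"
  "zero (hom_group A a b) = HZero A a b"
  "add (hom_group A a b) = HAdd A"
  by (simp_all add: hom_group_def)

lemma HZero_hom: "\<lbrakk>a \<in> Obj A; b \<in> Obj A\<rbrakk> \<Longrightarrow> HZero A a b \<in> Hom A a b"
  using abelian_group.axioms(1)[OF hom_abelian_group, THEN abelian_monoid.zero_closed] by simp

text \<open>Composition with a fixed arrow is a homomorphism of groups: it is additive, and an additive map
  between groups preserves zero because zero is the only solution of \<open>x + x = x\<close>.\<close>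

lemma cmp_zero_right:
  assumes "h \<in> Hom A b c" "a \<in> Obj A"
  shows "Cmp A h (HZero A a b) = HZero A a c"
proof -
  have b: "b \<in> Obj A" and c: "c \<in> Obj A" using HomD assms by auto
  interpret G: abelian_group "hom_group A a b" using hom_abelian_group assms b by blast
  interpret G': abelian_group "hom_group A a c" using hom_abelian_group assms c by blast
  let ?z = "Cmp A h (HZero A a b)"
  have z: "HZero A a b \<in> Hom A a b" using HZero_hom assms b by blast
  then have "HAdd A ?z ?z = ?z"
    using cmp_add_right[OF z z assms(1)] G.l_zero[of "HZero A a b"] by simp
  moreover have "?z \<in> Hom A a c" using cmp_hom z assms by blast
  ultimately show ?thesis
    by (metis G'.add.l_cancel_one hom_group_simps)
qed

lemma cmp_zero_left:
  assumes "f \<in> Hom A a b" "c \<in> Obj A"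
  shows "Cmp A (HZero A b c) f = HZero A a c"
proof -
  have a: "a \<in> Obj A" and b: "b \<in> Obj A" using HomD assms by auto
  interpret G: abelian_group "hom_group A b c" using hom_abelian_group assms b by blast
  interpret G': abelian_group "hom_group A a c" using hom_abelian_group assms a by blast
  let ?z = "Cmp A (HZero A b c) f"
  have z: "HZero A b c \<in> Hom A b c" using HZero_hom assms b by blast
  then have "HAdd A ?z ?z = ?z"
    using cmp_add_left[OF assms(1) z z] G.l_zero[of "HZero A b c"] by simp
  moreover have "?z \<in> Hom A a c" using cmp_hom z assms by blast
  ultimately show ?thesis
    by (metis G'.add.l_cancel_one hom_group_simps)
qed

lemma finsum_hom:
  assumes "a \<in> Obj A" "b \<in> Obj A" "\<And>i. i \<in> I \<Longrightarrow> f i \<in> Hom A a b"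
  shows "finsum (hom_group A a b) f I \<in> Hom A a b"
proof -
  interpret G: abelian_group "hom_group A a b" using hom_abelian_group assms by blast
  show ?thesis using G.finsum_closed[of f I] assms(3) by auto
qed

lemma finsum_insert_hom:
  assumes "a \<in> Obj A" "b \<in> Obj A" "finite I" "i \<notin> I" "\<And>j. j \<in> insert i I \<Longrightarrow> f j \<in> Hom A a b"
  shows "finsum (hom_group A a b) f (insert i I) = HAdd A (f i) (finsum (hom_group A a b) f I)"
proof -
  interpret G: abelian_group "hom_group A a b" using hom_abelian_group assms by blast
  show ?thesis using G.finsum_insert[of I i f] assms by auto
qed

lemma finsum_empty_hom:
  assumes "a \<in> Obj A" "b \<in> Obj A"
  shows "finsum (hom_group A a b) f {} = HZero A a b"
proof -
  interpret G: abelian_group "hom_group A a b" using hom_abelian_group assms by blast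
  show ?thesis by simp
qed

lemma finsum_cong_hom:
  assumes "a \<in> Obj A" "b \<in> Obj A" "\<And>i. i \<in> I \<Longrightarrow> g i \<in> Hom A a b" "\<And>i. i \<in> I \<Longrightarrow> f i = g i"
  shows "finsum (hom_group A a b) f I = finsum (hom_group A a b) g I"
proof -
  interpret G: abelian_group "hom_group A a b" using hom_abelian_group assms by blast
  show ?thesis by (rule G.finsum_cong') (use assms in auto)
qed

lemma finsum_reindex_hom:
  assumes "a \<in> Obj A" "b \<in> Obj A" "bij_betw h I J" "\<And>j. j \<in> J \<Longrightarrow> f j \<in> Hom A a b"
  shows "finsum (hom_group A a b) (\<lambda>i. f (h i)) I = finsum (hom_group A a b) f J"
proof -
  interpret G: abelian_group "hom_group A a b" using hom_abelian_group assms by blast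
  show ?thesis using G.finsum_reindex[of f h I] assms by (auto simp: bij_betw_def)
qed

lemma finsum_single_hom:
  assumes "a \<in> Obj A" "b \<in> Obj A" "finite I" "i \<in> I" "g \<in> Hom A a b"
  shows "finsum (hom_group A a b) (\<lambda>j. if i = j then g else HZero A a b) I = g"
proof -
  interpret G: abelian_group "hom_group A a b" using hom_abelian_group assms by blast
  show ?thesis using G.finsum_singleton[of i I "\<lambda>_. g"] assms by (simp cong: if_cong)
qed

lemma cmp_finsum_right:
  assumes "finite I" "h \<in> Hom A b c" "a \<in> Obj A" "\<And>i. i \<in> I \<Longrightarrow> f i \<in> Hom A a b"
  shows "Cmp A h (finsum (hom_group A a b) f I) = finsum (hom_group A a c) (\<lambda>i. Cmp A h (f i)) I"
  using assms(1,4)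
proof (induction I rule: finite_induct)
  case empty
  then show ?case using assms HomD by (simp add: finsum_empty_hom cmp_zero_right)
next
  case (insert i I)
  have "b \<in> Obj A" "c \<in> Obj A" using assms HomD by auto
  note bc = this
  have "Cmp A h (finsum (hom_group A a b) f (insert i I))
      = Cmp A h (HAdd A (f i) (finsum (hom_group A a b) f I))"
    using finsum_insert_hom[of a b I i f] insert assms bc by auto
  also have "\<dots> = HAdd A (Cmp A h (f i)) (Cmp A h (finsum (hom_group A a b) f I))"
    by (rule cmp_add_right[OF _ finsum_hom assms(2)]) (use insert assms bc in auto)
  also have "\<dots> = finsum (hom_group A a c) (\<lambda>i. Cmp A h (f i)) (insert i I)"
    using finsum_insert_hom[of a c I i "\<lambda>i. Cmp A h (f i)"] cmp_hom[OF _ assms(2)] insert assms bc by auto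
  finally show ?case .
qed

lemma cmp_finsum_left:
  assumes "finite I" "h \<in> Hom A a b" "c \<in> Obj A" "\<And>i. i \<in> I \<Longrightarrow> f i \<in> Hom A b c"
  shows "Cmp A (finsum (hom_group A b c) f I) h = finsum (hom_group A a c) (\<lambda>i. Cmp A (f i) h) I"
  using assms(1,4)
proof (induction I rule: finite_induct)
  case empty
  then show ?case using assms HomD by (simp add: finsum_empty_hom cmp_zero_left)
next
  case (insert i I)
  have "a \<in> Obj A" "b \<in> Obj A" using assms HomD by auto
  note ab = this
  have "Cmp A (finsum (hom_group A b c) f (insert i I)) h
      = Cmp A (HAdd A (f i) (finsum (hom_group A b c) f I)) h"
    using finsum_insert_hom[of b c I i f] insert assms ab by auto
  also have "\<dots> = HAdd A (Cmp A (f i) h) (Cmp A (finsum (hom_group A b c) f I) h)"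
    by (rule cmp_add_left[OF assms(2) _ finsum_hom]) (use insert assms ab in auto)
  also have "\<dots> = finsum (hom_group A a c) (\<lambda>i. Cmp A (f i) h) (insert i I)"
    using finsum_insert_hom[of a c I i "\<lambda>i. Cmp A (f i) h"] cmp_hom[OF assms(2)] insert assms ab by auto
  finally show ?case .
qed

lemma alternating_sum_hom:
  assumes "a \<in> Obj A" "b \<in> Obj A" "\<And>l. l \<le> n \<Longrightarrow> f l \<in> Hom A a b"
  shows "alternating_sum A a b n f \<in> Hom A a b"
proof -
  interpret G: abelian_group "hom_group A a b" using hom_abelian_group assms by blast
  show ?thesis unfolding alternating_sum_def
    using G.finsum_closed[of "\<lambda>l. add_pow (hom_group A a b) ((- 1) ^ l :: int) (f l)" "{..n}"] assms
      G.add.int_pow_closed by auto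
qed

lemma alternating_sum_cong:
  assumes "a \<in> Obj A" "b \<in> Obj A" "\<And>l. l \<le> n \<Longrightarrow> g l \<in> Hom A a b" "\<And>l. l \<le> n \<Longrightarrow> f l = g l"
  shows "alternating_sum A a b n f = alternating_sum A a b n g"
proof -
  interpret G: abelian_group "hom_group A a b" using hom_abelian_group assms by blast
  show ?thesis unfolding alternating_sum_def
    by (rule finsum_cong_hom) (use assms G.add.int_pow_closed in auto)
qed


section \<open>Finite direct sums\<close>

text \<open>The arrow with prescribed components \<open>g i\<close> is the sum of the \<open>incl i \<circ> g i\<close>.\<close>

lemma direct_sum_lift:
  assumes "direct_sum A I G P pr incl" "a \<in> Obj A" "\<And>i. i \<in> I \<Longrightarrow> g i \<in> Hom A a (G i)"
  shows "\<exists>d \<in> Hom A a P. \<forall>i \<in> I. Cmp A (pr i) d = g i"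
proof -
  note ds = assms(1)[unfolded direct_sum_def]
  have P: "P \<in> Obj A" and fin: "finite I"
    and hom: "\<And>i. i \<in> I \<Longrightarrow> pr i \<in> Hom A P (G i)" "\<And>i. i \<in> I \<Longrightarrow> incl i \<in> Hom A (G i) P"
    and G: "\<And>i. i \<in> I \<Longrightarrow> G i \<in> Obj A"
    and orth: "\<And>i j. \<lbrakk>i \<in> I; j \<in> I\<rbrakk> \<Longrightarrow>
      Cmp A (pr i) (incl j) = (if i = j then Idt A (G i) else HZero A (G j) (G i))"
    using ds by auto
  define d where "d = finsum (hom_group A a P) (\<lambda>j. Cmp A (incl j) (g j)) I"
  have c: "Cmp A (incl j) (g j) \<in> Hom A a P" if "j \<in> I" for j
    using cmp_hom[OF assms(3) hom(2)] that by blast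
  have "Cmp A (pr i) d = g i" if i: "i \<in> I" for i
  proof -
    have "Cmp A (pr i) (Cmp A (incl j) (g j)) = (if i = j then g i else HZero A a (G i))"
      if j: "j \<in> I" for j
    proof -
      have "Cmp A (pr i) (Cmp A (incl j) (g j)) = Cmp A (Cmp A (pr i) (incl j)) (g j)"
        using cmp_assoc[OF assms(3) hom(2) hom(1)] i j by blast
      also have "\<dots> = (if i = j then g i else HZero A a (G i))"
        using idt_cmp[OF assms(3)] cmp_zero_left[OF assms(3) G] i j by (auto simp: orth)
      finally show ?thesis .
    qed
    note comp = this
    have "Cmp A (pr i) d = finsum (hom_group A a (G i)) (\<lambda>j. Cmp A (pr i) (Cmp A (incl j) (g j))) I"
      unfolding d_def by (rule cmp_finsum_right) (use fin hom i c assms(2) in auto)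
    also have "\<dots> = finsum (hom_group A a (G i)) (\<lambda>j. if i = j then g i else HZero A a (G i)) I"
      by (rule finsum_cong_hom) (use G i comp assms in \<open>auto simp: HZero_hom\<close>)
    also have "\<dots> = g i" by (rule finsum_single_hom) (use G fin i assms in auto)
    finally show ?thesis .
  qed
  moreover have "d \<in> Hom A a P" unfolding d_def by (rule finsum_hom) (use P c assms in auto)
  ultimately show ?thesis by blast
qed

text \<open>The summands enter the definition only through an unordered sum and through conditions on
  single indices and on pairs of indices, all of which a bijection transports.\<close>

lemma direct_sum_reindex:
  assumes b: "bij_betw b I J"
    and G: "\<And>i. i \<in> I \<Longrightarrow> G i = G' (b i)"
    and pr: "\<And>i. i \<in> I \<Longrightarrow> pr i = pr' (b i)"
    and incl: "\<And>i. i \<in> I \<Longrightarrow> incl i = incl' (b i)"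
  shows "direct_sum A I G P pr incl \<longleftrightarrow> direct_sum A J G' P pr' incl'"
proof -
  have J: "J = b ` I" and inj: "inj_on b I" using b by (auto simp: bij_betw_def)
  let ?s = "finsum (hom_group A P P) (\<lambda>i. Cmp A (incl i) (pr i)) I"
  let ?s' = "finsum (hom_group A P P) (\<lambda>j. Cmp A (incl' j) (pr' j)) J"
  have sum: "?s = ?s'" if "P \<in> Obj A" "\<forall>j \<in> J. pr' j \<in> Hom A P (G' j) \<and> incl' j \<in> Hom A (G' j) P"
  proof -
    have c: "Cmp A (incl' j) (pr' j) \<in> Hom A P P" if "j \<in> J" for j
      using cmp_hom that \<open>\<forall>j \<in> J. _\<close> by blast
    have "?s = finsum (hom_group A P P) (\<lambda>i. Cmp A (incl' (b i)) (pr' (b i))) I"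
      by (rule finsum_cong_hom) (use that pr incl c J in auto)
    also have "\<dots> = ?s'" by (rule finsum_reindex_hom[OF _ _ b]) (use that c in auto)
    finally show ?thesis .
  qed
  have fin: "finite J \<longleftrightarrow> finite I" using bij_betw_finite[OF b] by simp
  have arrows: "(\<forall>i \<in> I. G i \<in> Obj A \<and> pr i \<in> Hom A P (G i) \<and> incl i \<in> Hom A (G i) P) \<longleftrightarrow>
      (\<forall>j \<in> J. G' j \<in> Obj A \<and> pr' j \<in> Hom A P (G' j) \<and> incl' j \<in> Hom A (G' j) P)"
    unfolding J using G pr incl by simp
  have orth: "(\<forall>i \<in> I. \<forall>j \<in> I. Cmp A (pr i) (incl j)
        = (if i = j then Idt A (G i) else HZero A (G j) (G i))) \<longleftrightarrow>
      (\<forall>i \<in> J. \<forall>j \<in> J. Cmp A (pr' i) (incl' j)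
        = (if i = j then Idt A (G' i) else HZero A (G' j) (G' i)))"
    unfolding J using G pr incl inj_on_eq_iff[OF inj] by simp
  show ?thesis unfolding direct_sum_def fin arrows orth
    by (intro conj_cong refl) (use sum in auto)
qed

end

text \<open>Induction on the index set: the empty sum is the zero object, and a sum with one more summand is
  the binary sum of that summand with the sum already built; the old projections and
  injections are composed with those of the binary sum.\<close>

lemma (in abelian_category) ex_direct_sum:
  assumes "finite I" "\<And>i. i \<in> I \<Longrightarrow> G i \<in> Obj A"
  shows "\<exists>P pr incl. direct_sum A I G P pr incl"
  using assms
proof (induction I rule: finite_induct)
  case empty
  obtain z where z: "zero_object A z" using ex_zero_object by blast
  then have zO: "z \<in> Obj A" and "\<exists>!f. f \<in> Hom A z z" by (auto simp: zero_object_def)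
  \<comment> \<open>The sum of the empty family of \<open>incl i \<circ> pr i\<close> is the zero arrow, which is the
    identity of a zero object.\<close>
  then have "HZero A z z = Idt A z" using HZero_hom idt_hom by blast
  then have "direct_sum A {} G z undefined undefined"
    using zO by (simp add: direct_sum_def finsum_empty_hom)
  then show ?case by blast
next
  case (insert i I)
  then obtain P pr incl where P: "direct_sum A I G P pr incl" by blast
  note ds = P[unfolded direct_sum_def]
  have Gi: "G i \<in> Obj A" and PO: "P \<in> Obj A" using insert ds by auto
  \<comment> \<open>The index \<open>True\<close> stands for the new summand and \<open>False\<close> for the sum \<open>P\<close> of the old ones.\<close>
  obtain Q q j where Q: "direct_sum A (UNIV :: bool set) (\<lambda>c. if c then G i else P) Q q j"
    using ex_binary_direct_sum[OF Gi PO] by blast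
  have QO: "Q \<in> Obj A"
    and q1: "q True \<in> Hom A Q (G i)" and q2: "q False \<in> Hom A Q P"
    and j1: "j True \<in> Hom A (G i) Q" and j2: "j False \<in> Hom A P Q"
    using Q unfolding direct_sum_def by (auto simp: UNIV_bool)
  have qj: "Cmp A (q True) (j True) = Idt A (G i)" "Cmp A (q False) (j False) = Idt A P"
      "Cmp A (q True) (j False) = HZero A P (G i)" "Cmp A (q False) (j True) = HZero A (G i) P"
    using Q unfolding direct_sum_def by (auto simp: UNIV_bool)
  have j1q1: "Cmp A (j True) (q True) \<in> Hom A Q Q" and j2q2: "Cmp A (j False) (q False) \<in> Hom A Q Q"
    using cmp_hom q1 q2 j1 j2 by blast+
  have sumQ: "HAdd A (Cmp A (j True) (q True)) (Cmp A (j False) (q False)) = Idt A Q"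
  proof -
    interpret E: abelian_group "hom_group A Q Q" using hom_abelian_group QO by blast
    have "Idt A Q = finsum (hom_group A Q Q) (\<lambda>c. Cmp A (j c) (q c)) (UNIV :: bool set)"
      using Q unfolding direct_sum_def by simp
    also have "(UNIV :: bool set) = {True, False}" by auto
    also have "finsum (hom_group A Q Q) (\<lambda>c. Cmp A (j c) (q c)) {True, False}
        = HAdd A (Cmp A (j True) (q True)) (Cmp A (j False) (q False))"
      using E.finsum_insert[of "{False}" True "\<lambda>c. Cmp A (j c) (q c)"]
        E.finsum_insert[of "{}" False "\<lambda>c. Cmp A (j c) (q c)"] j1q1 j2q2 E.r_zero[of "Cmp A (j False) (q False)"]
      by auto
    finally show ?thesis by simp
  qed
  define pr' where "pr' k = (if k = i then q True else Cmp A (pr k) (q False))" for k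
  define incl' where "incl' k = (if k = i then j True else Cmp A (j False) (incl k))" for k
  have i': "pr' i = q True" "incl' i = j True" by (simp_all add: pr'_def incl'_def)
  have k': "pr' k = Cmp A (pr k) (q False)" "incl' k = Cmp A (j False) (incl k)" if "k \<in> I" for k
    using that insert by (auto simp: pr'_def incl'_def)
  have pr: "pr k \<in> Hom A P (G k)" and incl: "incl k \<in> Hom A (G k) P" and G: "G k \<in> Obj A"
    if "k \<in> I" for k using ds that by auto
  have pr'_hom: "pr' k \<in> Hom A Q (G k)" and incl'_hom: "incl' k \<in> Hom A (G k) Q"
    if "k \<in> insert i I" for k
    using that q1 j1 cmp_hom[OF q2 pr] cmp_hom[OF incl j2] by (auto simp: pr'_def incl'_def)
  have orth: "Cmp A (pr' k) (incl' l) = (if k = l then Idt A (G k) else HZero A (G l) (G k))"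
    if k: "k \<in> insert i I" and l: "l \<in> insert i I" for k l
  proof -
    consider "k = i" "l = i" | "k = i" "l \<in> I" | "k \<in> I" "l = i" | "k \<in> I" "l \<in> I" using k l by auto
    then show ?thesis
    proof cases
      case 1
      then show ?thesis by (simp add: i' qj)
    next
      case 2
      then have "Cmp A (pr' k) (incl' l) = Cmp A (Cmp A (q True) (j False)) (incl l)"
        using cmp_assoc[OF incl j2 q1] by (simp add: i' k')
      then show ?thesis using 2 insert cmp_zero_left[OF incl Gi] by (auto simp: qj)
    next
      case 3
      then have "Cmp A (pr' k) (incl' l) = Cmp A (pr k) (Cmp A (q False) (j True))"
        using cmp_assoc[OF j1 q2 pr] by (simp add: i' k')
      then show ?thesis using 3 insert cmp_zero_right[OF pr Gi] by (auto simp: qj)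
    next
      case 4
      have "Cmp A (pr' k) (incl' l) = Cmp A (pr k) (Cmp A (q False) (Cmp A (j False) (incl l)))"
        using cmp_assoc[OF cmp_hom[OF incl j2] q2 pr] 4 by (simp add: k')
      also have "Cmp A (q False) (Cmp A (j False) (incl l)) = incl l"
        using cmp_assoc[OF incl j2 q2] idt_cmp[OF incl] 4 by (simp add: qj)
      finally show ?thesis using ds 4 by auto
    qed
  qed
  have "finsum (hom_group A Q Q) (\<lambda>k. Cmp A (incl' k) (pr' k)) I
      = finsum (hom_group A Q Q) (\<lambda>k. Cmp A (j False) (Cmp A (Cmp A (incl k) (pr k)) (q False))) I"
  proof (rule finsum_cong_hom[OF QO QO])
    fix k assume k: "k \<in> I"
    have ip: "Cmp A (incl k) (pr k) \<in> Hom A P P" using cmp_hom[OF pr incl] k by blast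
    show "Cmp A (j False) (Cmp A (Cmp A (incl k) (pr k)) (q False)) \<in> Hom A Q Q"
      using cmp_hom[OF cmp_hom[OF q2 ip] j2] .
    show "Cmp A (incl' k) (pr' k) = Cmp A (j False) (Cmp A (Cmp A (incl k) (pr k)) (q False))"
      using cmp_assoc[OF cmp_hom[OF q2 pr[OF k]] incl[OF k] j2] cmp_assoc[OF q2 pr[OF k] incl[OF k]] k
      by (simp add: k')
  qed
  also have "\<dots> = Cmp A (j False) (finsum (hom_group A Q P) (\<lambda>k. Cmp A (Cmp A (incl k) (pr k)) (q False)) I)"
    using cmp_finsum_right[OF _ j2 QO, of I] cmp_hom[OF q2 cmp_hom[OF pr incl]] ds by simp
  also have "\<dots> = Cmp A (j False) (Cmp A (finsum (hom_group A P P) (\<lambda>k. Cmp A (incl k) (pr k)) I) (q False))"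
    using cmp_finsum_left[OF _ q2 PO, of I "\<lambda>k. Cmp A (incl k) (pr k)"] cmp_hom[OF pr incl] ds by simp
  also have "\<dots> = Cmp A (j False) (q False)" using ds idt_cmp[OF q2] by simp
  finally have "finsum (hom_group A Q Q) (\<lambda>k. Cmp A (incl' k) (pr' k)) (insert i I) = Idt A Q"
    using finsum_insert_hom[OF QO QO insert.hyps, of "\<lambda>k. Cmp A (incl' k) (pr' k)"]
      cmp_hom[OF pr'_hom incl'_hom] sumQ by (simp add: i')
  then have "direct_sum A (insert i I) G Q pr' incl'"
    unfolding direct_sum_def using insert QO pr'_hom incl'_hom orth by auto
  then show ?case by blast
qed


section \<open>The categories of finite sets, of all maps between the sets [n], and of a preorder\<close>

lemma category_fin_sets: "category fin_sets"
proof
  fix f a b assume "f \<in> Hom fin_sets a b"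
  then show "Cmp fin_sets f (Idt fin_sets a) = f" "Cmp fin_sets (Idt fin_sets b) f = f"
    by (auto simp: Hom_def fin_sets_def compose_def restrict_def PiE_iff extensional_def fun_eq_iff)
next
  fix f a b g c h d
  assume "f \<in> Hom fin_sets a b" "g \<in> Hom fin_sets b c" "h \<in> Hom fin_sets c d"
  then show "Cmp fin_sets h (Cmp fin_sets g f) = Cmp fin_sets (Cmp fin_sets h g) f"
    by (auto simp: Hom_def fin_sets_def compose_def PiE_iff fun_eq_iff)
qed (auto simp: Hom_def fin_sets_def compose_def PiE_iff)

lemma category_opposite_bang_Delta: "category (opposite bang_Delta)"
proof
  fix f a b assume "f \<in> Hom (opposite bang_Delta) a b"
  then show "Cmp (opposite bang_Delta) f (Idt (opposite bang_Delta) a) = f"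
    "Cmp (opposite bang_Delta) (Idt (opposite bang_Delta) b) f = f"
    by (auto simp: Hom_def bang_Delta_def opposite_def compose_def restrict_def PiE_iff
        extensional_def fun_eq_iff)
next
  fix f a b g c h d
  assume "f \<in> Hom (opposite bang_Delta) a b" "g \<in> Hom (opposite bang_Delta) b c"
    "h \<in> Hom (opposite bang_Delta) c d"
  then show "Cmp (opposite bang_Delta) h (Cmp (opposite bang_Delta) g f)
      = Cmp (opposite bang_Delta) (Cmp (opposite bang_Delta) h g) f"
    by (auto simp: Hom_def bang_Delta_def opposite_def compose_def PiE_iff fun_eq_iff)
qed (auto simp: Hom_def bang_Delta_def opposite_def compose_def PiE_iff)

lemma category_preorder_cat:
  assumes "\<And>x. x \<in> P \<Longrightarrow> leq x x"
    and "\<And>x y z. \<lbrakk>x \<in> P; y \<in> P; z \<in> P; leq x y; leq y z\<rbrakk> \<Longrightarrow> leq x z"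
  shows "category (preorder_cat P leq)"
  by unfold_locales (auto simp: Hom_def preorder_cat_def assms(1) intro: assms(2))


section \<open>The symmetric simplicial set of a hypergraph\<close>

lemma finite_ktuples:
  assumes "is_hypergraph H"
  shows "finite (ktuples H n)"
proof -
  have "finite (hcells H)" using assms by (simp add: is_hypergraph_def hcells_def)
  moreover have "finite {vs. length vs = Suc n \<and> set vs \<subseteq> cell_verts H x}" if "x \<in> hcells H" for x
  proof -
    have "finite (cell_verts H x)"
    proof (cases x)
      case (Inl e)
      then have "ends H e \<subseteq> verts H" "finite (verts H)"
        using that assms by (auto simp: is_hypergraph_def hcells_def)
      then show ?thesis using Inl by (simp add: cell_verts_def finite_subset)
    qed (simp add: cell_verts_def)
    from finite_lists_length_eq[OF this, of "Suc n"] show ?thesis by (simp add: conj_commute)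
  qed
  ultimately show ?thesis unfolding ktuples_def by (rule finite_SigmaI)
qed

lemma Kset_eq: "Kset H n = (\<lambda>(x, vs). kclass H n x vs) ` ktuples H n"
  by (auto simp: Kset_def quotient_def kclass_def)

lemma Kset_cases:
  assumes "c \<in> Kset H n"
  obtains x vs where "(x, vs) \<in> ktuples H n" "c = kclass H n x vs"
  using assms unfolding Kset_eq by fast

lemma kclass_in_Kset: "(x, vs) \<in> ktuples H n \<Longrightarrow> kclass H n x vs \<in> Kset H n"
  by (auto simp: Kset_eq)

lemma finite_Kset: "is_hypergraph H \<Longrightarrow> finite (Kset H n)"
  by (simp add: Kset_eq finite_ktuples)

lemma FObj_Kcomplex [simp]: "FObj (Kcomplex H) n = Kset H n"
  by (simp add: Kcomplex_def)

lemma FArr_Kcomplex: "FArr (Kcomplex H) (m, n, mu)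
    = (Kset H n, Kset H m, restrict (sact (Kcomplex H) m n mu) (Kset H n))"
  by (simp add: Kcomplex_def sact_def)

lemma sact_Kcomplex_in:
  assumes "mu \<in> {..m} \<rightarrow>\<^sub>E {..n}" "c \<in> Kset H n"
  shows "sact (Kcomplex H) m n mu c \<in> Kset H m"
  using assms(2) by (rule Kset_cases) (simp add: Kcomplex_act precompose_ktuples kclass_in_Kset assms(1))

lemma precompose_id: "length vs = Suc n \<Longrightarrow> precompose n (\<lambda>i \<in> {..n}. i) vs = vs"
  by (rule nth_equalityI) (auto simp: precompose_def simp del: upt_Suc)

lemma precompose_compose:
  assumes "nu \<in> {..k} \<rightarrow>\<^sub>E {..m}"
  shows "precompose k (compose {..k} mu nu) vs = precompose k nu (precompose m mu vs)"
proof (rule nth_equalityI)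
  fix i assume "i < length (precompose k (compose {..k} mu nu) vs)"
  then have "i \<le> k" by (simp add: precompose_def)
  moreover from this have "nu i \<le> m" using assms by (auto simp: PiE_iff)
  ultimately show "precompose k (compose {..k} mu nu) vs ! i = precompose k nu (precompose m mu vs) ! i"
    by (simp add: precompose_def compose_def less_Suc_eq_le del: upt_Suc)
qed (simp add: precompose_def)

text \<open>Functoriality can be checked on representatives, where the operators are precomposition of
  tuples with maps of index sets.\<close>

lemma symmetric_sset_Kcomplex:
  assumes "is_hypergraph H"
  shows "symmetric_sset (Kcomplex H)"
proof -
  interpret source: category "opposite bang_Delta" by (rule category_opposite_bang_Delta)
  interpret target: category fin_sets by (rule category_fin_sets)
  show ?thesis
  proof
    fix n :: nat
    show "FObj (Kcomplex H) n \<in> Obj fin_sets" using finite_Kset[OF assms] by (simp add: fin_sets_def)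
    have "sact (Kcomplex H) n n (\<lambda>i \<in> {..n}. i) c = c" if "c \<in> Kset H n" for c
    proof -
      obtain x vs where vs: "(x, vs) \<in> ktuples H n" and c: "c = kclass H n x vs"
        using \<open>c \<in> Kset H n\<close> by (rule Kset_cases)
      then have "length vs = Suc n" by (simp add: ktuples_def)
      then show ?thesis using Kcomplex_act[OF vs, of "\<lambda>i \<in> {..n}. i" n] by (simp add: c precompose_id)
    qed
    then have "restrict (sact (Kcomplex H) n n (\<lambda>i \<in> {..n}. i)) (Kset H n) = (\<lambda>c \<in> Kset H n. c)"
      by (rule restrict_ext)
    then show "FArr (Kcomplex H) (Idt (opposite bang_Delta) n) = Idt fin_sets (FObj (Kcomplex H) n)"
      by (simp add: bang_Delta_def opposite_def fin_sets_def FArr_Kcomplex)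
  next
    fix f a b assume f: "f \<in> Hom (opposite bang_Delta) a b"
    then obtain mu where "f = (b, a, mu)" "mu \<in> {..b} \<rightarrow>\<^sub>E {..a}"
      by (auto simp: Hom_def bang_Delta_def opposite_def)
    then show "FArr (Kcomplex H) f \<in> Hom fin_sets (FObj (Kcomplex H) a) (FObj (Kcomplex H) b)"
      using finite_Kset[OF assms] by (auto simp: FArr_Kcomplex Hom_def fin_sets_def sact_Kcomplex_in)
  next
    fix f a b g c assume f: "f \<in> Hom (opposite bang_Delta) a b" and g: "g \<in> Hom (opposite bang_Delta) b c"
    then obtain mu nu where f': "f = (b, a, mu)" "mu \<in> {..b} \<rightarrow>\<^sub>E {..a}"
      and g': "g = (c, b, nu)" "nu \<in> {..c} \<rightarrow>\<^sub>E {..b}"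
      by (auto simp: Hom_def bang_Delta_def opposite_def)
    have comp: "compose {..c} mu nu \<in> {..c} \<rightarrow>\<^sub>E {..a}" using f' g' by (auto simp: compose_def PiE_iff)
    have "sact (Kcomplex H) c a (compose {..c} mu nu) z
        = sact (Kcomplex H) c b nu (sact (Kcomplex H) b a mu z)" if "z \<in> Kset H a" for z
    proof -
      obtain x vs where vs: "(x, vs) \<in> ktuples H a" and z: "z = kclass H a x vs"
        using \<open>z \<in> Kset H a\<close> by (rule Kset_cases)
      show ?thesis
        using Kcomplex_act[OF vs comp] Kcomplex_act[OF vs f'(2)]
          Kcomplex_act[OF precompose_ktuples[OF vs f'(2)] g'(2)]
        by (simp add: z precompose_compose[OF g'(2)])
    qed
    then show "FArr (Kcomplex H) (Cmp (opposite bang_Delta) g f)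
        = Cmp fin_sets (FArr (Kcomplex H) g) (FArr (Kcomplex H) f)"
      using sact_Kcomplex_in[OF f'(2)]
      by (auto simp: f'(1) g'(1) FArr_Kcomplex bang_Delta_def opposite_def fin_sets_def compose_def fun_eq_iff)
  qed
qed


section \<open>Simplices of K(L) as tuples spanning a simplex\<close>

text \<open>The class of a tuple consists of that tuple placed in each cell that contains it, so a simplex of
  \<open>K(L)\<close> is determined by its tuple alone. The two definitions below give the tuples that occur and
  name their classes without a choice of cell.\<close>

definition spanning_tuples :: "'v set set \<Rightarrow> nat \<Rightarrow> 'v list set" where
  "spanning_tuples L n = {vs. length vs = Suc n \<and> set vs \<in> L}"

definition tuple_class :: "'v set set \<Rightarrow> nat \<Rightarrow> 'v list \<Rightarrow> (('v set + 'v) \<times> 'v list) set" where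
  "tuple_class L n vs = {p \<in> ktuples (hypergraph_of L) n. snd p = vs}"

abbreviation vertex_class :: "'v set set \<Rightarrow> 'v \<Rightarrow> (('v set + 'v) \<times> 'v list) set" where
  "vertex_class L v \<equiv> tuple_class L 0 [v]"

locale simplicial_complex =
  fixes L :: "'v set set"
  assumes complex: "finite_simplicial_complex L"
begin

lemma simplexD: "s \<in> L \<Longrightarrow> finite s" "s \<in> L \<Longrightarrow> s \<noteq> {}"
  "\<lbrakk>s \<in> L; t \<noteq> {}; t \<subseteq> s\<rbrakk> \<Longrightarrow> t \<in> L"
  using complex unfolding finite_simplicial_complex_def by blast+

lemma simplex_vertices: "\<lbrakk>s \<in> L; v \<in> s\<rbrakk> \<Longrightarrow> v \<in> vertices L"
  using simplexD(3)[of s "{v}"] by (auto simp: vertices_def)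

lemma finite_simplices: "finite (simplices L k)"
  using complex by (simp add: simplices_def finite_simplicial_complex_def)

lemma simplices_0: "simplices L 0 = (\<lambda>v. {v}) ` vertices L"
  by (auto simp: simplices_def vertices_def card_1_singleton_iff)

lemma is_hypergraph_of: "is_hypergraph (hypergraph_of L)"
proof -
  have "finite L" using complex by (simp add: finite_simplicial_complex_def)
  moreover have "vertices L \<subseteq> \<Union> L" by (auto simp: vertices_def)
  then have "finite (vertices L)"
    using \<open>finite L\<close> simplexD(1) by (meson finite_Union finite_subset)
  moreover have "s \<subseteq> vertices L \<and> s \<noteq> {} \<and> (\<forall>v. s \<noteq> {v})" if "s \<in> L - simplices L 0" for s
    using that simplex_vertices[of s] simplexD(2)[of s] by (auto simp: simplices_def)
  ultimately show ?thesis by (simp add: is_hypergraph_def hypergraph_of_def)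
qed

lemma cell_verts_simplex: "x \<in> hcells (hypergraph_of L) \<Longrightarrow> cell_verts (hypergraph_of L) x \<in> L"
  by (auto simp: hcells_def cell_verts_def hypergraph_of_def vertices_def)

lemma simplex_is_cell:
  assumes "s \<in> L"
  shows "\<exists>x \<in> hcells (hypergraph_of L). cell_verts (hypergraph_of L) x = s"
proof (cases "s \<in> simplices L 0")
  case True
  then obtain v where "v \<in> vertices L" "s = {v}" by (auto simp: simplices_0)
  then show ?thesis
    by (intro bexI[of _ "Inr v"]) (auto simp: hcells_def cell_verts_def hypergraph_of_def)
next
  case False
  then show ?thesis using assms
    by (intro bexI[of _ "Inl s"]) (auto simp: hcells_def cell_verts_def hypergraph_of_def)
qed

text \<open>Closure of \<open>L\<close> under nonempty subsets turns the entries of a tuple in a cell into a simplex;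
  conversely that simplex is itself a cell containing the tuple.\<close>

lemma ktuples_spanning: "(x, vs) \<in> ktuples (hypergraph_of L) n \<Longrightarrow> vs \<in> spanning_tuples L n"
  using simplexD(3)[OF cell_verts_simplex, of x "set vs"]
  by (cases vs) (auto simp: ktuples_def spanning_tuples_def)

lemma spanning_ktuples: "vs \<in> spanning_tuples L n \<Longrightarrow> \<exists>x. (x, vs) \<in> ktuples (hypergraph_of L) n"
  using simplex_is_cell[of "set vs"] by (auto simp: ktuples_def spanning_tuples_def)

lemma kclass_eq_tuple_class:
  "(x, vs) \<in> ktuples (hypergraph_of L) n \<Longrightarrow> kclass (hypergraph_of L) n x vs = tuple_class L n vs"
  by (auto simp: kclass_eq tuple_class_def)

lemma kclass_vertex:
  "v \<in> vertices L \<Longrightarrow> kclass (hypergraph_of L) 0 (Inr v) [v] = vertex_class L v"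
  by (rule kclass_eq_tuple_class) (auto simp: ktuples_def hcells_def cell_verts_def hypergraph_of_def)

lemma Kset_tuple_class: "Kset (hypergraph_of L) n = tuple_class L n ` spanning_tuples L n"
proof -
  have "Kset (hypergraph_of L) n = (\<lambda>(x, vs). tuple_class L n vs) ` ktuples (hypergraph_of L) n"
    unfolding Kset_eq by (rule image_cong) (auto simp: kclass_eq_tuple_class)
  also have "\<dots> = tuple_class L n ` spanning_tuples L n"
    using ktuples_spanning spanning_ktuples by (force simp: image_iff)
  finally show ?thesis .
qed

lemma entries_tuple_class: "vs \<in> spanning_tuples L n \<Longrightarrow> entries (tuple_class L n vs) = set vs"
  using spanning_ktuples[of vs n] by (auto simp: entries_def tuple_class_def)

lemma inj_on_tuple_class: "inj_on (tuple_class L n) (spanning_tuples L n)"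
proof
  fix vs ws assume "vs \<in> spanning_tuples L n" and eq: "tuple_class L n vs = tuple_class L n ws"
  then obtain x where "(x, vs) \<in> ktuples (hypergraph_of L) n" using spanning_ktuples by blast
  then have "(x, vs) \<in> tuple_class L n vs" by (simp add: tuple_class_def)
  then show "vs = ws" unfolding eq by (simp add: tuple_class_def)
qed

lemma precompose_spanning:
  "\<lbrakk>vs \<in> spanning_tuples L n; mu \<in> {..m} \<rightarrow>\<^sub>E {..n}\<rbrakk> \<Longrightarrow> precompose m mu vs \<in> spanning_tuples L m"
  using spanning_ktuples precompose_ktuples ktuples_spanning by blast

lemma sact_tuple_class:
  assumes "vs \<in> spanning_tuples L n" "mu \<in> {..m} \<rightarrow>\<^sub>E {..n}"
  shows "sact (KL L) m n mu (tuple_class L n vs) = tuple_class L m (precompose m mu vs)"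
proof -
  obtain x where x: "(x, vs) \<in> ktuples (hypergraph_of L) n" using spanning_ktuples assms by blast
  show ?thesis
    using Kcomplex_act[OF x assms(2)] kclass_eq_tuple_class[OF x]
      kclass_eq_tuple_class[OF precompose_ktuples[OF x assms(2)]] by simp
qed

lemma vertex_spanning: "v \<in> vertices L \<longleftrightarrow> [v] \<in> spanning_tuples L 0"
  by (simp add: spanning_tuples_def vertices_def)

lemma spanning_tuples_0: "spanning_tuples L 0 = (\<lambda>v. [v]) ` vertices L"
  by (auto simp: spanning_tuples_def vertices_def length_Suc_conv)

lemma inj_on_vertex_class: "inj_on (vertex_class L) (vertices L)"
proof (rule inj_onI)
  fix v w assume "v \<in> vertices L" "w \<in> vertices L" "vertex_class L v = vertex_class L w"
  then have "[v] = [w]" by (intro inj_onD[OF inj_on_tuple_class, of 0]) (simp_all add: vertex_spanning)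
  then show "v = w" by simp
qed

lemma bij_betw_vertex_class: "bij_betw (vertex_class L) (vertices L) (Kset (hypergraph_of L) 0)"
  using inj_on_vertex_class by (simp add: bij_betw_def Kset_tuple_class spanning_tuples_0 image_image)

lemma bij_betw_vertices:
  "bij_betw (\<lambda>v. kclass (hypergraph_of L) 0 (Inr v) [v]) (vertices L) (FObj (KL L) 0)"
  using bij_betw_vertex_class
  by (subst bij_betw_cong[of _ _ "vertex_class L"]) (simp_all add: kclass_vertex)

lemma hat_cases:
  assumes "p \<in> hat (KL L)"
  obtains n vs where "p = (n, tuple_class L n vs)" "vs \<in> spanning_tuples L n"
  using assms by (auto simp: hat_def Kset_tuple_class)

lemma entries_hat: "p \<in> hat (KL L) \<Longrightarrow> entries (snd p) \<in> L"
  by (erule hat_cases) (simp add: entries_tuple_class, simp add: spanning_tuples_def)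

text \<open>If every entry of \<open>vs\<close> occurs in \<open>ws\<close>, then a map of index sets that sends each position of
  \<open>vs\<close> to a position of the same entry in \<open>ws\<close> exhibits the class of \<open>vs\<close> as a degenerate face of
  the class of \<open>ws\<close>; conversely reindexing never creates new entries.\<close>

lemma hat_le_iff:
  assumes "p \<in> hat (KL L)" "q \<in> hat (KL L)"
  shows "hat_le (KL L) p q \<longleftrightarrow> entries (snd p) \<subseteq> entries (snd q)"
proof -
  obtain m vs where p: "p = (m, tuple_class L m vs)" and vs: "vs \<in> spanning_tuples L m"
    using assms(1) by (rule hat_cases)
  obtain n ws where q: "q = (n, tuple_class L n ws)" and ws: "ws \<in> spanning_tuples L n"
    using assms(2) by (rule hat_cases)
  have len: "length vs = Suc m" "length ws = Suc n" using vs ws by (auto simp: spanning_tuples_def)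
  have "hat_le (KL L) p q \<longleftrightarrow> (\<exists>mu \<in> {..m} \<rightarrow>\<^sub>E {..n}. precompose m mu ws = vs)"
    unfolding hat_le_def p q
    using sact_tuple_class[OF ws] inj_on_eq_iff[OF inj_on_tuple_class precompose_spanning[OF ws] vs] by auto
  also have "\<dots> \<longleftrightarrow> set vs \<subseteq> set ws"
  proof
    assume "\<exists>mu \<in> {..m} \<rightarrow>\<^sub>E {..n}. precompose m mu ws = vs"
    then show "set vs \<subseteq> set ws"
      using len by (auto simp: precompose_def PiE_iff less_Suc_eq_le simp del: upt_Suc)
  next
    assume sub: "set vs \<subseteq> set ws"
    have "\<exists>j \<le> n. ws ! j = vs ! i" if "i \<le> m" for i
    proof -
      have "vs ! i \<in> set ws" using sub that len by (auto simp: less_Suc_eq_le)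
      then show ?thesis using len by (auto simp: in_set_conv_nth less_Suc_eq_le)
    qed
    then obtain f where f: "\<And>i. i \<le> m \<Longrightarrow> f i \<le> n \<and> ws ! f i = vs ! i" by metis
    have "precompose m (\<lambda>i \<in> {..m}. f i) ws = vs"
      by (rule nth_equalityI) (use f len in \<open>auto simp: precompose_def less_Suc_eq_le simp del: upt_Suc\<close>)
    moreover have "(\<lambda>i \<in> {..m}. f i) \<in> {..m} \<rightarrow>\<^sub>E {..n}" using f by auto
    ultimately show "\<exists>mu \<in> {..m} \<rightarrow>\<^sub>E {..n}. precompose m mu ws = vs" by blast
  qed
  finally show ?thesis using vs ws by (simp add: p q entries_tuple_class)
qed

text \<open>Taking entries is a monotone map from the preorder of simplices of \<open>K(L)\<close> to \<open>L\<close>, and equivalent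
  simplices have the same entries, so the two comparison arrows between them are identities of \<open>L\<close>.\<close>

lemma sheaf_on_KL_in_Cell:
  assumes "cellular_sheaf A L F"
  shows "sheaf_on_KL F \<in> Cell (KL L) A"
proof -
  interpret F: cat_functor "preorder_cat L (\<subseteq>)" A F by (rule assms)
  interpret P: category "preorder_cat (hat (KL L)) (hat_le (KL L))"
    by (rule category_preorder_cat) (simp_all add: hat_le_iff)
  have "cat_functor (preorder_cat (hat (KL L)) (hat_le (KL L))) A (sheaf_on_KL F)"
  proof
    fix p assume "p \<in> Obj (preorder_cat (hat (KL L)) (hat_le (KL L)))"
    then have e: "entries (snd p) \<in> L" by (simp add: preorder_cat_def entries_hat)
    show "FObj (sheaf_on_KL F) p \<in> Obj A"
      using F.fobj[of "entries (snd p)"] e by (simp add: sheaf_on_KL_def preorder_cat_def)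
    show "FArr (sheaf_on_KL F) (Idt (preorder_cat (hat (KL L)) (hat_le (KL L))) p)
        = Idt A (FObj (sheaf_on_KL F) p)"
      using F.f_idt[of "entries (snd p)"] e by (simp add: sheaf_on_KL_def preorder_cat_def)
  next
    fix f p q assume "f \<in> Hom (preorder_cat (hat (KL L)) (hat_le (KL L))) p q"
    then have f: "f = (p, q)" and "p \<in> hat (KL L)" "q \<in> hat (KL L)" "hat_le (KL L) p q"
      by (auto simp: Hom_def preorder_cat_def)
    then have "entries (snd p) \<in> L" "entries (snd q) \<in> L" "entries (snd p) \<subseteq> entries (snd q)"
      by (simp_all add: entries_hat hat_le_iff)
    then show "FArr (sheaf_on_KL F) f \<in> Hom A (FObj (sheaf_on_KL F) p) (FObj (sheaf_on_KL F) q)"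
      unfolding f using F.farr[of "(entries (snd p), entries (snd q))" "entries (snd p)" "entries (snd q)"]
      by (simp add: sheaf_on_KL_def preorder_cat_def Hom_def)
  next
    fix f p q g s assume "f \<in> Hom (preorder_cat (hat (KL L)) (hat_le (KL L))) p q"
      "g \<in> Hom (preorder_cat (hat (KL L)) (hat_le (KL L))) q s"
    then have fg: "f = (p, q)" "g = (q, s)" and "p \<in> hat (KL L)" "q \<in> hat (KL L)" "s \<in> hat (KL L)"
        "hat_le (KL L) p q" "hat_le (KL L) q s"
      by (auto simp: Hom_def preorder_cat_def)
    then have "entries (snd p) \<in> L" "entries (snd q) \<in> L" "entries (snd s) \<in> L"
      "entries (snd p) \<subseteq> entries (snd q)" "entries (snd q) \<subseteq> entries (snd s)"
      by (simp_all add: entries_hat hat_le_iff)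
    then show "FArr (sheaf_on_KL F) (Cmp (preorder_cat (hat (KL L)) (hat_le (KL L))) g f)
        = Cmp A (FArr (sheaf_on_KL F) g) (FArr (sheaf_on_KL F) f)"
      unfolding fg using F.f_cmp[of "(entries (snd p), entries (snd q))" "entries (snd p)" "entries (snd q)"
          "(entries (snd q), entries (snd s))" "entries (snd s)"]
      by (simp add: sheaf_on_KL_def preorder_cat_def Hom_def)
  qed
  moreover have "FObj (sheaf_on_KL F) p = FObj (sheaf_on_KL F) q
      \<and> FArr (sheaf_on_KL F) (p, q) = Idt A (FObj (sheaf_on_KL F) p)
      \<and> FArr (sheaf_on_KL F) (q, p) = Idt A (FObj (sheaf_on_KL F) p)"
    if "p \<in> hat (KL L)" "q \<in> hat (KL L)" "hat_le (KL L) p q" "hat_le (KL L) q p" for p q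
  proof -
    have "entries (snd p) = entries (snd q)" using that by (simp add: hat_le_iff)
    then show ?thesis using F.f_idt[of "entries (snd q)"] entries_hat[OF that(2)]
      by (simp add: sheaf_on_KL_def preorder_cat_def)
  qed
  ultimately show ?thesis unfolding Cell_def by blast
qed

lemma vertex_tuple_tuple_class:
  assumes "vs \<in> spanning_tuples L n"
  shows "vertex_tuple (KL L) n (tuple_class L n vs) = map (vertex_class L) vs"
proof (rule nth_equalityI)
  fix i assume "i < length (vertex_tuple (KL L) n (tuple_class L n vs))"
  then have "i \<le> n" by (simp add: vertex_tuple_def)
  then show "vertex_tuple (KL L) n (tuple_class L n vs) ! i = map (vertex_class L) vs ! i"
    using assms sact_tuple_class[OF assms, of "\<lambda>j \<in> {..0}. i" 0]
    by (simp add: vertex_tuple_def spanning_tuples_def precompose_def less_Suc_eq_le nth_append del: upt_Suc)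
      (simp add: PiE_iff)
qed (use assms in \<open>simp add: vertex_tuple_def spanning_tuples_def\<close>)

lemma inj_on_map_vertex_class: "inj_on (map (vertex_class L)) (spanning_tuples L n)"
proof -
  have "set vs \<subseteq> vertices L" if "vs \<in> spanning_tuples L n" for vs
    using that simplex_vertices by (auto simp: spanning_tuples_def)
  then show ?thesis
    using inj_on_subset[OF inj_on_vertex_class] by (intro inj_onI) (metis Un_least inj_on_map_eq_map)
qed

text \<open>A common upper bound of some vertices is a simplex of \<open>L\<close> that contains them, and by downward
  closure they then span a simplex of \<open>L\<close> themselves.\<close>

lemma cech_nerve_KL: "cech_nerve (KL L) n = map (vertex_class L) ` spanning_tuples L n"
proof
  show "map (vertex_class L) ` spanning_tuples L n \<subseteq> cech_nerve (KL L) n"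
  proof safe
    fix vs assume vs: "vs \<in> spanning_tuples L n"
    have v: "v \<in> vertices L" if "v \<in> set vs" for v
      using that vs simplex_vertices by (auto simp: spanning_tuples_def)
    have z: "(n, tuple_class L n vs) \<in> hat (KL L)" using vs by (simp add: hat_def Kset_tuple_class)
    have "(n, tuple_class L n vs) \<in> upper_set (KL L) (vertex_class L v)" if "v \<in> set vs" for v
    proof -
      have "(0, vertex_class L v) \<in> hat (KL L)"
        using v[OF that] by (simp add: hat_def Kset_tuple_class vertex_spanning)
      then show ?thesis
        using z that v[OF that] vs
        by (simp add: upper_set_def hat_le_iff entries_tuple_class vertex_spanning)
    qed
    then have "(\<Inter>y \<in> set (map (vertex_class L) vs). upper_set (KL L) y) \<noteq> {}" by auto
    then show "map (vertex_class L) vs \<in> cech_nerve (KL L) n"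
      using vs v by (auto simp: cech_nerve_def spanning_tuples_def[of _ n] Kset_tuple_class vertex_spanning)
  qed
next
  show "cech_nerve (KL L) n \<subseteq> map (vertex_class L) ` spanning_tuples L n"
  proof
    fix ys assume "ys \<in> cech_nerve (KL L) n"
    then have len: "length ys = Suc n" and sub: "set ys \<subseteq> vertex_class L ` vertices L"
      and "(\<Inter>y \<in> set ys. upper_set (KL L) y) \<noteq> {}"
      by (auto simp: cech_nerve_def Kset_tuple_class spanning_tuples_0)
    then obtain z where z: "\<And>y. y \<in> set ys \<Longrightarrow> z \<in> upper_set (KL L) y" by auto
    have "ys \<noteq> []" using len by auto
    then have zh: "z \<in> hat (KL L)" using z[of "hd ys"] by (simp add: upper_set_def)
    have "ys \<in> map (vertex_class L) ` lists (vertices L)"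
      using sub unfolding lists_image[symmetric] by (simp add: in_lists_conv_set subset_eq)
    then obtain vs where ys: "ys = map (vertex_class L) vs" and vs: "set vs \<subseteq> vertices L"
      by (auto simp: in_lists_conv_set)
    have "v \<in> entries (snd z)" if "v \<in> set vs" for v
    proof -
      have v: "[v] \<in> spanning_tuples L 0" using that vs vertex_spanning by blast
      then have "(0, vertex_class L v) \<in> hat (KL L)" by (simp add: hat_def Kset_tuple_class)
      moreover have "hat_le (KL L) (0, vertex_class L v) z"
        using z[of "vertex_class L v"] that by (simp add: ys upper_set_def)
      ultimately show ?thesis using zh v by (simp add: hat_le_iff entries_tuple_class)
    qed
    then have "set vs \<in> L" using simplexD(3)[OF entries_hat[OF zh], of "set vs"] \<open>ys \<noteq> []\<close> ys by auto
    then show "ys \<in> map (vertex_class L) ` spanning_tuples L n"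
      using len by (auto simp: ys spanning_tuples_def)
  qed
qed

text \<open>Under the names given by spanning tuples, the vertex map replaces each entry by its vertex class,
  which loses nothing.\<close>

lemma bij_betw_vertex_tuple: "bij_betw (vertex_tuple (KL L) n) (Kset (hypergraph_of L) n) (cech_nerve (KL L) n)"
proof -
  have "inj_on (vertex_tuple (KL L) n \<circ> tuple_class L n) (spanning_tuples L n)"
    using inj_on_map_vertex_class[of n] vertex_tuple_tuple_class by (simp cong: inj_on_cong)
  then have "inj_on (vertex_tuple (KL L) n) (Kset (hypergraph_of L) n)"
    by (simp add: Kset_tuple_class inj_on_imageI)
  moreover have "vertex_tuple (KL L) n ` Kset (hypergraph_of L) n = cech_nerve (KL L) n"
    unfolding Kset_tuple_class cech_nerve_KL image_image by (simp add: vertex_tuple_tuple_class cong: image_cong)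
  ultimately show ?thesis by (simp add: bij_betw_def)
qed

lemma is_cech_KL: "is_cech (KL L)"
  unfolding is_cech_def using symmetric_sset_Kcomplex[OF is_hypergraph_of] bij_betw_vertex_tuple by simp

lemma simplex_of_tuple_KL:
  assumes "vs \<in> spanning_tuples L n"
  shows "simplex_of_tuple (KL L) n (map (vertex_class L) vs) = tuple_class L n vs"
  unfolding simplex_of_tuple_def
  using the_inv_into_f_eq[OF bij_betw_imp_inj_on[OF bij_betw_vertex_tuple] vertex_tuple_tuple_class[OF assms]]
    assms by (simp add: Kset_tuple_class)

lemma precompose_coface:
  assumes "length vs = Suc (Suc k)" "l \<le> Suc k"
  shows "precompose k (\<lambda>i \<in> {..k}. if i < l then i else Suc i) vs = take l vs @ drop (Suc l) vs"
  by (rule nth_equalityI)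
    (use assms in \<open>auto simp: precompose_def nth_append min_def simp del: upt_Suc\<close>)

lemma face_KL:
  assumes "vs \<in> spanning_tuples L (Suc k)" "l \<le> Suc k"
  shows "face (KL L) k l (tuple_class L (Suc k) vs) = tuple_class L k (take l vs @ drop (Suc l) vs)"
proof -
  have "(\<lambda>i \<in> {..k}. if i < l then i else Suc i) \<in> {..k} \<rightarrow>\<^sub>E {..Suc k}" by auto
  then show ?thesis
    unfolding face_def using assms precompose_coface[of vs k l]
    by (simp add: sact_tuple_class) (simp add: spanning_tuples_def)
qed

end


section \<open>Increasing listings\<close>

lemma increasing_distinct: "increasing r vs \<Longrightarrow> distinct vs"
  unfolding increasing_def by (induction vs) auto

lemma increasing_append:
  "increasing r (vs @ ws) \<longleftrightarrow> increasing r vs \<and> increasing r ws \<and>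
     (\<forall>v \<in> set vs. \<forall>w \<in> set ws. (v, w) \<in> r \<and> v \<noteq> w)"
  by (simp add: increasing_def sorted_wrt_append)

text \<open>The first entry is the least element of the set of entries; remove it and repeat.\<close>

lemma increasing_unique:
  assumes "antisym r" "increasing r vs" "increasing r ws" "set vs = set ws"
  shows "vs = ws"
  using assms(2-4)
proof (induction vs arbitrary: ws)
  case Nil
  then show ?case by simp
next
  case (Cons v vs)
  then obtain w ws' where ws: "ws = w # ws'" by (cases ws) auto
  have "v = w"
  proof (rule ccontr)
    assume "v \<noteq> w"
    moreover have "v \<in> set ws" "w \<in> set (v # vs)" using Cons.prems(3) ws by auto
    ultimately have "(w, v) \<in> r" "(v, w) \<in> r" using Cons.prems ws by (auto simp: increasing_def)
    then show False using \<open>v \<noteq> w\<close> antisymD[OF assms(1)] by blast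
  qed
  moreover have "set vs = set ws'"
  proof -
    have "set vs = set (v # vs) - {v}" "set ws' = set ws - {w}"
      using increasing_distinct[OF Cons.prems(1)] increasing_distinct[OF Cons.prems(2)] by (auto simp: ws)
    then show ?thesis using Cons.prems(3) \<open>v = w\<close> by metis
  qed
  ultimately show ?case using Cons by (simp add: ws increasing_def)
qed

text \<open>A new element is inserted between those below it and those above it.\<close>

lemma ex_increasing:
  assumes r: "linear_order_on V r" and "finite s" "s \<subseteq> V"
  shows "\<exists>vs. set vs = s \<and> increasing r vs"
  using assms(2,3)
proof (induction s rule: finite_induct)
  case empty
  then show ?case by (simp add: increasing_def)
next
  case (insert x s)
  have tr: "trans r" and an: "antisym r" and tot: "total_on V r" using r by (auto simp: order_on_defs)
  obtain vs where vs: "set vs = s" and inc: "increasing r vs" using insert by auto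
  define lo where "lo = filter (\<lambda>y. (y, x) \<in> r) vs"
  define hi where "hi = filter (\<lambda>y. (x, y) \<in> r) vs"
  have inc': "increasing r lo" "increasing r hi"
    using inc by (auto simp: lo_def hi_def increasing_def sorted_wrt_filter)
  have "(y, z) \<in> r \<and> y \<noteq> z" if "y \<in> set lo" "z \<in> insert x (set hi)" for y z
  proof -
    have "y \<in> s" "(y, x) \<in> r" "z = x \<or> (x, z) \<in> r" using that vs by (auto simp: lo_def hi_def)
    then show ?thesis using insert.hyps transD[OF tr] antisymD[OF an] by blast
  qed
  moreover have "(x, z) \<in> r \<and> x \<noteq> z" if "z \<in> set hi" for z
    using that insert.hyps vs by (auto simp: hi_def)
  ultimately have "increasing r (lo @ [x] @ hi)"
    using inc' unfolding increasing_append by (simp add: increasing_def)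
  moreover have "set (lo @ [x] @ hi) = insert x s"
    using tot insert vs by (auto simp: lo_def hi_def total_on_def)
  ultimately show ?case by blast
qed

lemma listing_eqI:
  assumes "antisym r" "increasing r vs"
  shows "listing r (set vs) = vs"
  unfolding listing_def by (rule the_equality) (use assms increasing_unique in auto)

lemma listing_props:
  assumes "linear_order_on V r" "finite s" "s \<subseteq> V"
  shows "set (listing r s) = s" "increasing r (listing r s)" "length (listing r s) = card s"
proof -
  obtain vs where vs: "set vs = s" "increasing r vs" using ex_increasing[OF assms] by blast
  moreover have "antisym r" using assms(1) by (auto simp: order_on_defs)
  ultimately have "listing r s = vs" using listing_eqI by blast
  then show "set (listing r s) = s" "increasing r (listing r s)" "length (listing r s) = card s"
    using vs distinct_card[OF increasing_distinct[OF vs(2)]] by simp_all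
qed

lemma set_delete_nth:
  assumes "distinct vs" "l < length vs"
  shows "set (take l vs @ drop (Suc l) vs) = set vs - {vs ! l}"
proof -
  have vs: "vs = take l vs @ vs ! l # drop (Suc l) vs" using assms(2) by (rule id_take_nth_drop)
  have "distinct (take l vs @ vs ! l # drop (Suc l) vs)" using assms(1) vs by simp
  then show ?thesis by (subst (3) vs) auto
qed

lemma increasing_delete_nth:
  assumes "increasing r vs" "l < length vs"
  shows "increasing r (take l vs @ drop (Suc l) vs)"
proof -
  have "increasing r (take l vs @ [vs ! l] @ drop (Suc l) vs)"
    using assms id_take_nth_drop[of l vs] by simp
  then show ?thesis unfolding increasing_append by simp
qed

lemma listing_simplex_face:
  assumes "linear_order_on V r" "finite s" "s \<subseteq> V" "l < card s"
  shows "listing r (simplex_face r l s) = take l (listing r s) @ drop (Suc l) (listing r s)"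
proof -
  note lst = listing_props[OF assms(1-3)]
  have "antisym r" using assms(1) by (auto simp: order_on_defs)
  then show ?thesis
    using listing_eqI[OF _ increasing_delete_nth[OF lst(2)], of l]
      set_delete_nth[OF increasing_distinct[OF lst(2)], of l] lst assms(4)
    by (simp add: simplex_face_def)
qed


section \<open>Increasing tuples of K(L) and simplices of L\<close>

text \<open>The order on the vertices of \<open>K(L)\<close> is the image of the one on \<open>L\<close>. Transitivity and antisymmetry
  survive because \<open>r\<close> relates only elements of \<open>V\<close>, where \<open>f\<close> is injective.\<close>

lemma linear_order_on_image:
  assumes "linear_order_on V r" "inj_on f V"
  shows "linear_order_on (f ` V) (map_prod f f ` r)"
proof -
  have sub: "r \<subseteq> V \<times> V" and re: "refl_on V r" and tr: "trans r" and an: "antisym r" and tot: "total_on V r"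
    using assms(1) by (auto simp: order_on_defs)
  have eq: "v = w" if "f v = f w" "(v, v') \<in> r \<or> (v', v) \<in> r" "(w, w') \<in> r \<or> (w', w) \<in> r" for v w v' w'
    using that sub inj_onD[OF assms(2)] by blast
  have "map_prod f f ` r \<subseteq> f ` V \<times> f ` V" using sub by auto
  moreover have "refl_on (f ` V) (map_prod f f ` r)" using re by (auto simp: refl_on_def)
  moreover have "trans (map_prod f f ` r)"
  proof (rule transI)
    fix a b c assume "(a, b) \<in> map_prod f f ` r" "(b, c) \<in> map_prod f f ` r"
    then obtain u v v' w where "(u, v) \<in> r" "(v', w) \<in> r" "a = f u" "b = f v" "b = f v'" "c = f w" by auto
    moreover from this have "v = v'" using eq[of v v' u w] by simp
    ultimately show "(a, c) \<in> map_prod f f ` r" using transD[OF tr, of u v w] by auto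
  qed
  moreover have "antisym (map_prod f f ` r)"
  proof (rule antisymI)
    fix a b assume "(a, b) \<in> map_prod f f ` r" "(b, a) \<in> map_prod f f ` r"
    then obtain u v v' u' where "(u, v) \<in> r" "(v', u') \<in> r" "a = f u" "b = f v" "b = f v'" "a = f u'" by auto
    moreover from this have "v = v'" "u = u'" using eq[of v v' u u'] eq[of u u' v v'] by simp_all
    ultimately show "a = b" using antisymD[OF an, of u v] by auto
  qed
  moreover have "total_on (f ` V) (map_prod f f ` r)"
  proof (rule total_onI)
    fix a b assume "a \<in> f ` V" "b \<in> f ` V" "a \<noteq> b"
    then obtain u v where "u \<in> V" "v \<in> V" "a = f u" "b = f v" "u \<noteq> v" by auto
    moreover from this have "(u, v) \<in> r \<or> (v, u) \<in> r" using tot by (simp add: total_on_def)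
    ultimately show "(a, b) \<in> map_prod f f ` r \<or> (b, a) \<in> map_prod f f ` r" by auto
  qed
  ultimately show ?thesis by (simp add: order_on_defs)
qed

locale ordered_simplicial_complex = simplicial_complex L for L :: "'v set set" +
  fixes r :: "'v rel"
  assumes linear_order: "linear_order_on (vertices L) r"
begin

lemma KL_order_eq: "KL_order L r = map_prod (vertex_class L) (vertex_class L) ` r"
proof -
  have "r \<subseteq> vertices L \<times> vertices L" using linear_order by (simp add: order_on_defs)
  then show ?thesis unfolding KL_order_def by (force simp: kclass_vertex)
qed

lemma linear_order_on_KL: "linear_order_on (FObj (KL L) 0) (KL_order L r)"
  using linear_order_on_image[OF linear_order inj_on_vertex_class] bij_betw_vertex_class
  by (simp add: KL_order_eq bij_betw_def)

lemma increasing_map_vertex_class: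
  assumes "set vs \<subseteq> vertices L"
  shows "increasing (KL_order L r) (map (vertex_class L) vs) \<longleftrightarrow> increasing r vs"
proof -
  have sub: "r \<subseteq> vertices L \<times> vertices L" using linear_order by (simp add: order_on_defs)
  have "(vertex_class L v, vertex_class L w) \<in> KL_order L r \<and> vertex_class L v \<noteq> vertex_class L w
      \<longleftrightarrow> (v, w) \<in> r \<and> v \<noteq> w" if v: "v \<in> vertices L" and w: "w \<in> vertices L" for v w
  proof -
    have "(v, w) \<in> r" if rel: "(vertex_class L v, vertex_class L w) \<in> KL_order L r"
    proof -
      obtain v' w' where "(v', w') \<in> r" "vertex_class L v = vertex_class L v'" "vertex_class L w = vertex_class L w'"
        using rel by (auto simp: KL_order_eq)
      then show ?thesis using sub v w inj_onD[OF inj_on_vertex_class] by blast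
    qed
    moreover have "(vertex_class L v, vertex_class L w) \<in> KL_order L r" if "(v, w) \<in> r"
      using that by (force simp: KL_order_eq)
    ultimately show ?thesis using inj_on_eq_iff[OF inj_on_vertex_class v w] by blast
  qed
  note iff = this
  show ?thesis
    unfolding increasing_def sorted_wrt_map
    by (rule iffI; erule sorted_wrt_mono_rel[rotated]) (use iff assms in blast)+
qed

text \<open>The correspondence of summands. One function serves all degrees, since the cardinality of a simplex
  fixes its degree.\<close>

definition ordered_tuple :: "'v set \<Rightarrow> (('v set + 'v) \<times> 'v list) set list" where
  "ordered_tuple s = map (vertex_class L) (listing r s)"

lemma simplices_listing:
  assumes "s \<in> simplices L k"
  shows "listing r s \<in> spanning_tuples L k" "set (listing r s) = s" "increasing r (listing r s)"
proof -
  have "s \<in> L" "card s = Suc k" using assms by (auto simp: simplices_def)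
  moreover from this have "finite s" "s \<subseteq> vertices L" using simplexD(1) simplex_vertices by blast+
  ultimately show "listing r s \<in> spanning_tuples L k" "set (listing r s) = s" "increasing r (listing r s)"
    using listing_props[OF linear_order, of s] by (auto simp: spanning_tuples_def)
qed

lemma bij_betw_ordered_tuple:
  "bij_betw ordered_tuple (simplices L k) (increasing_tuples (KL L) (KL_order L r) k)"
proof -
  have an: "antisym r" using linear_order by (simp add: order_on_defs)
  have V: "set vs \<subseteq> vertices L" if "vs \<in> spanning_tuples L k" for vs
    using that simplex_vertices by (auto simp: spanning_tuples_def)
  have "inj_on ordered_tuple (simplices L k)"
  proof (rule inj_onI)
    fix s t assume s: "s \<in> simplices L k" and t: "t \<in> simplices L k" and "ordered_tuple s = ordered_tuple t"
    then have "listing r s = listing r t"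
      using inj_onD[OF inj_on_map_vertex_class _ simplices_listing(1)[OF s] simplices_listing(1)[OF t]]
      by (simp add: ordered_tuple_def)
    then show "s = t" using simplices_listing(2)[OF s] simplices_listing(2)[OF t] by metis
  qed
  moreover have "ordered_tuple ` simplices L k = increasing_tuples (KL L) (KL_order L r) k"
  proof
    show "ordered_tuple ` simplices L k \<subseteq> increasing_tuples (KL L) (KL_order L r) k"
    proof
      fix ys assume "ys \<in> ordered_tuple ` simplices L k"
      then obtain s where s: "s \<in> simplices L k" and ys: "ys = map (vertex_class L) (listing r s)"
        by (auto simp: ordered_tuple_def)
      show "ys \<in> increasing_tuples (KL L) (KL_order L r) k"
        using simplices_listing(1,3)[OF s] increasing_map_vertex_class[OF V]
        by (simp add: ys increasing_tuples_def cech_nerve_KL)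
    qed
    show "increasing_tuples (KL L) (KL_order L r) k \<subseteq> ordered_tuple ` simplices L k"
    proof
      fix ys assume "ys \<in> increasing_tuples (KL L) (KL_order L r) k"
      then obtain vs where ys: "ys = map (vertex_class L) vs" and vs: "vs \<in> spanning_tuples L k"
        and "increasing (KL_order L r) ys"
        by (auto simp: increasing_tuples_def cech_nerve_KL)
      then have inc: "increasing r vs" using increasing_map_vertex_class V by blast
      then have "ys = ordered_tuple (set vs)" by (simp add: ordered_tuple_def ys listing_eqI[OF an])
      moreover have "set vs \<in> simplices L k"
        using vs distinct_card[OF increasing_distinct[OF inc]] by (simp add: simplices_def spanning_tuples_def)
      ultimately show "ys \<in> ordered_tuple ` simplices L k" by blast
    qed
  qed
  ultimately show ?thesis by (simp add: bij_betw_def)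
qed

lemma ordered_tuple_eq:
  assumes "s \<in> simplices L k" "x \<in> hcells (hypergraph_of L)" "s \<subseteq> cell_verts (hypergraph_of L) x"
  shows "ordered_tuple s = vertex_tuple (KL L) k (kclass (hypergraph_of L) k x (listing r s))"
proof -
  have "(x, listing r s) \<in> ktuples (hypergraph_of L) k"
    using assms simplices_listing[OF assms(1)] by (auto simp: ktuples_def spanning_tuples_def)
  then show ?thesis
    using simplices_listing(1)[OF assms(1)]
    by (simp add: kclass_eq_tuple_class vertex_tuple_tuple_class ordered_tuple_def)
qed

lemma simplex_of_ordered_tuple:
  "s \<in> simplices L k \<Longrightarrow> simplex_of_tuple (KL L) k (ordered_tuple s) = tuple_class L k (listing r s)"
  by (simp add: ordered_tuple_def simplex_of_tuple_KL simplices_listing)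

lemma simplex_face_simplices:
  assumes "t \<in> simplices L (Suc k)" "l \<le> Suc k"
  shows "simplex_face r l t \<in> simplices L k"
proof -
  have tL: "t \<in> L" and card: "card t = Suc (Suc k)" using assms by (auto simp: simplices_def)
  have "length (listing r t) = Suc (Suc k)"
    using simplices_listing(1)[OF assms(1)] by (simp add: spanning_tuples_def)
  then have "listing r t ! l \<in> t"
    using nth_mem[of l "listing r t"] assms simplices_listing(2)[OF assms(1)] by simp
  then have c: "card (simplex_face r l t) = Suc k"
    using card simplexD(1)[OF tL] by (simp add: simplex_face_def)
  then have "simplex_face r l t \<noteq> {}" by auto
  then show ?thesis using simplexD(3)[OF tL, of "simplex_face r l t"] c
    by (auto simp: simplices_def simplex_face_def)
qed

text \<open>Faces in \<open>L\<close> remove the \<open>l\<close>-th vertex from a set and faces in \<open>K(L)\<close> remove the \<open>l\<close>-th entry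
  from a tuple; on increasing listings these are the same operation.\<close>

lemma face_listing:
  assumes "t \<in> simplices L (Suc k)" "l \<le> Suc k"
  shows "face (KL L) k l (tuple_class L (Suc k) (listing r t)) = tuple_class L k (listing r (simplex_face r l t))"
proof -
  have tL: "t \<in> L" and card: "card t = Suc (Suc k)" using assms by (auto simp: simplices_def)
  then have "finite t" "t \<subseteq> vertices L" using simplexD(1) simplex_vertices by blast+
  then show ?thesis
    using listing_simplex_face[OF linear_order, of t l] face_KL[OF simplices_listing(1)[OF assms(1)] assms(2)]
      card assms(2) by simp
qed


section \<open>Comparison of the two cochain complexes\<close>

lemma FObj_sheaf_tuple_class:
  "vs \<in> spanning_tuples L n \<Longrightarrow> FObj (sheaf_on_KL F) (n, tuple_class L n vs) = FObj F (set vs)"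
  by (simp add: sheaf_on_KL_def entries_tuple_class)

lemma FArr_sheaf_tuple_class:
  "\<lbrakk>vs \<in> spanning_tuples L m; ws \<in> spanning_tuples L n\<rbrakk> \<Longrightarrow>
   FArr (sheaf_on_KL F) ((m, tuple_class L m vs), (n, tuple_class L n ws)) = FArr F (set vs, set ws)"
  by (simp add: sheaf_on_KL_def entries_tuple_class)

lemma sheaf_arrow_hom:
  assumes "cellular_sheaf A L F" "t \<in> simplices L (Suc k)" "l \<le> Suc k"
  shows "FArr F (simplex_face r l t, t) \<in> Hom A (FObj F (simplex_face r l t)) (FObj F t)"
proof -
  interpret F: cat_functor "preorder_cat L (\<subseteq>)" A F by (rule assms(1))
  have "simplex_face r l t \<in> L" "t \<in> L" using assms simplex_face_simplices by (auto simp: simplices_def)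
  moreover have "simplex_face r l t \<subseteq> t" by (auto simp: simplex_face_def)
  ultimately show ?thesis by (intro F.farr) (simp add: Hom_def preorder_cat_def)
qed

text \<open>Relating \<open>K\<close> and \<open>K'\<close> only by their values on simplices and on the corresponding tuples
  covers both directions of relabelling at once: \<open>K'\<close> may be \<open>K\<close> relabelled by the inverse
  bijection, or \<open>K\<close> may be \<open>K'\<close> relabelled by the bijection.\<close>

lemma sheaf_cochains_iff_ordered_cochains:
  assumes A: "preadditive_category A" and F: "cellular_sheaf A L F"
    and CObj: "CObj K' = CObj K" and CDiff: "CDiff K' = CDiff K"
    and CProj: "\<And>k s. s \<in> simplices L k \<Longrightarrow> CProj K k s = CProj K' k (ordered_tuple s)"
    and CInj: "\<And>k s. s \<in> simplices L k \<Longrightarrow> CInj K k s = CInj K' k (ordered_tuple s)"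
  shows "is_sheaf_cochains A L r F K \<longleftrightarrow>
    is_ordered_cochains A (KL L) (KL_order L r) (sheaf_on_KL F) K'"
proof -
  interpret A: preadditive_category A by (rule A)
  let ?T = "increasing_tuples (KL L) (KL_order L r)"
  let ?G = "\<lambda>k ys. FObj (sheaf_on_KL F) (k, simplex_of_tuple (KL L) k ys)"
  have G: "FObj F s = ?G k (ordered_tuple s)" if "s \<in> simplices L k" for k s
    using that simplices_listing[OF that] by (simp add: simplex_of_ordered_tuple FObj_sheaf_tuple_class)
  have sums: "direct_sum A (simplices L k) (FObj F) (CObj K k) (CProj K k) (CInj K k) \<longleftrightarrow>
      direct_sum A (?T k) (?G k) (CObj K' k) (CProj K' k) (CInj K' k)" for k
    unfolding CObj by (rule A.direct_sum_reindex[OF bij_betw_ordered_tuple]) (simp_all add: G CProj CInj)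
  \<comment> \<open>The direct sum condition makes the summands arrows of the right group, which the
    comparison of sums in that group requires.\<close>
  have comp: "(\<forall>t \<in> simplices L (Suc k).
        Cmp A (CProj K (Suc k) t) (CDiff K k) =
        alternating_sum A (CObj K k) (FObj F t) (Suc k)
          (\<lambda>l. Cmp A (FArr F (simplex_face r l t, t)) (CProj K k (simplex_face r l t)))) \<longleftrightarrow>
      (\<forall>ys \<in> ?T (Suc k). let z = simplex_of_tuple (KL L) (Suc k) ys in
        Cmp A (CProj K' (Suc k) ys) (CDiff K' k) =
        alternating_sum A (CObj K' k) (FObj (sheaf_on_KL F) (Suc k, z)) (Suc k)
          (\<lambda>l. Cmp A (FArr (sheaf_on_KL F) ((k, face (KL L) k l z), (Suc k, z)))
                     (CProj K' k (vertex_tuple (KL L) k (face (KL L) k l z)))))"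
    if ds: "direct_sum A (simplices L k) (FObj F) (CObj K k) (CProj K k) (CInj K k)" for k
  proof -
    have img: "?T (Suc k) = ordered_tuple ` simplices L (Suc k)"
      using bij_betw_ordered_tuple by (simp add: bij_betw_def)
    have "alternating_sum A (CObj K k) (FObj F t) (Suc k)
          (\<lambda>l. Cmp A (FArr (sheaf_on_KL F) ((k, face (KL L) k l z), (Suc k, z)))
                     (CProj K' k (vertex_tuple (KL L) k (face (KL L) k l z))))
        = alternating_sum A (CObj K k) (FObj F t) (Suc k)
          (\<lambda>l. Cmp A (FArr F (simplex_face r l t, t)) (CProj K k (simplex_face r l t)))"
      if t: "t \<in> simplices L (Suc k)" and z: "z = tuple_class L (Suc k) (listing r t)" for t z
    proof (rule A.alternating_sum_cong)
      show "CObj K k \<in> Obj A" using ds by (simp add: direct_sum_def)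
      show "FObj F t \<in> Obj A" using A.HomD(2)[OF sheaf_arrow_hom[OF F t, of 0]] by simp
    next
      fix l assume l: "l \<le> Suc k"
      note f = simplex_face_simplices[OF t l]
      have "CProj K k (simplex_face r l t) \<in> Hom A (CObj K k) (FObj F (simplex_face r l t))"
        using ds f by (simp add: direct_sum_def)
      then show "Cmp A (FArr F (simplex_face r l t, t)) (CProj K k (simplex_face r l t))
          \<in> Hom A (CObj K k) (FObj F t)"
        using A.cmp_hom sheaf_arrow_hom[OF F t l] by blast
      show "Cmp A (FArr (sheaf_on_KL F) ((k, face (KL L) k l z), (Suc k, z)))
              (CProj K' k (vertex_tuple (KL L) k (face (KL L) k l z)))
          = Cmp A (FArr F (simplex_face r l t, t)) (CProj K k (simplex_face r l t))"
        using simplices_listing[OF t] simplices_listing[OF f]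
        by (simp add: z face_listing[OF t l] FArr_sheaf_tuple_class vertex_tuple_tuple_class CProj[OF f]
            ordered_tuple_def)
    qed
    note alt = this
    show ?thesis
      unfolding img ball_simps Let_def CObj CDiff
    proof (rule ball_cong[OF refl])
      fix t assume t: "t \<in> simplices L (Suc k)"
      show "(Cmp A (CProj K (Suc k) t) (CDiff K k) =
        alternating_sum A (CObj K k) (FObj F t) (Suc k)
          (\<lambda>l. Cmp A (FArr F (simplex_face r l t, t)) (CProj K k (simplex_face r l t)))) \<longleftrightarrow>
        (Cmp A (CProj K' (Suc k) (ordered_tuple t)) (CDiff K k) =
        alternating_sum A (CObj K k)
          (FObj (sheaf_on_KL F) (Suc k, simplex_of_tuple (KL L) (Suc k) (ordered_tuple t))) (Suc k)
          (\<lambda>l. Cmp A (FArr (sheaf_on_KL F)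
              ((k, face (KL L) k l (simplex_of_tuple (KL L) (Suc k) (ordered_tuple t))),
               (Suc k, simplex_of_tuple (KL L) (Suc k) (ordered_tuple t))))
            (CProj K' k (vertex_tuple (KL L) k
              (face (KL L) k l (simplex_of_tuple (KL L) (Suc k) (ordered_tuple t)))))))"
        unfolding G[OF t, symmetric] alt[OF t simplex_of_ordered_tuple[OF t]] CProj[OF t] ..
    qed
  qed
  show ?thesis
    unfolding is_sheaf_cochains_def is_ordered_cochains_def CDiff[symmetric]
    unfolding CDiff CObj sums[unfolded CObj, symmetric]
    using comp[unfolded CObj CDiff] by blast
qed

text \<open>The differential is the arrow into the direct sum whose components are the prescribed alternating
  sums.\<close>

lemma ex_sheaf_cochains:
  assumes A: "abelian_category A" and F: "cellular_sheaf A L F"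
  shows "\<exists>K. is_sheaf_cochains A L r F K"
proof -
  interpret A: abelian_category A by (rule A)
  interpret F: cat_functor "preorder_cat L (\<subseteq>)" A F by (rule F)
  have FObj: "FObj F s \<in> Obj A" if "s \<in> simplices L k" for s k
    using F.fobj[of s] that by (simp add: preorder_cat_def simplices_def)
  have "\<forall>k. \<exists>P pr incl. direct_sum A (simplices L k) (FObj F) P pr incl"
    using A.ex_direct_sum[OF finite_simplices] FObj by blast
  then obtain P pr incl where ds: "\<And>k. direct_sum A (simplices L k) (FObj F) (P k) (pr k) (incl k)"
    by metis
  define comp where "comp k t = alternating_sum A (P k) (FObj F t) (Suc k)
      (\<lambda>l. Cmp A (FArr F (simplex_face r l t, t)) (pr k (simplex_face r l t)))" for k t
  have P: "P k \<in> Obj A" for k using ds by (simp add: direct_sum_def)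
  have "comp k t \<in> Hom A (P k) (FObj F t)" if t: "t \<in> simplices L (Suc k)" for k t
    unfolding comp_def
  proof (rule A.alternating_sum_hom[OF P FObj[OF t]])
    fix l assume l: "l \<le> Suc k"
    have "pr k (simplex_face r l t) \<in> Hom A (P k) (FObj F (simplex_face r l t))"
      using ds simplex_face_simplices[OF t l] by (simp add: direct_sum_def)
    then show "Cmp A (FArr F (simplex_face r l t, t)) (pr k (simplex_face r l t)) \<in> Hom A (P k) (FObj F t)"
      using A.cmp_hom sheaf_arrow_hom[OF F t l] by blast
  qed
  then have "\<forall>k. \<exists>d \<in> Hom A (P k) (P (Suc k)). \<forall>t \<in> simplices L (Suc k). Cmp A (pr (Suc k) t) d = comp k t"
    using A.direct_sum_lift[OF ds P] by blast
  then obtain d where "\<And>k. d k \<in> Hom A (P k) (P (Suc k))"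
    "\<And>k t. t \<in> simplices L (Suc k) \<Longrightarrow> Cmp A (pr (Suc k) t) (d k) = comp k t" by metis
  then have "is_sheaf_cochains A L r F \<lparr>CObj = P, CProj = pr, CInj = incl, CDiff = d\<rparr>"
    using ds by (simp add: is_sheaf_cochains_def comp_def)
  then show ?thesis by blast
qed

end

theorem theorem4p9:
  fixes A :: "('o, 'a) addcat"
    and L :: "'v set set"
    and r :: "'v rel"
    and F :: "('v set, 'v set \<times> 'v set, 'o, 'a) func"
  assumes "abelian_category A"
    and "finite_simplicial_complex L"
    and "linear_order_on (vertices L) r"
    and "cellular_sheaf A L F"
  shows "is_hypergraph (hypergraph_of L)
    \<and> is_cech (KL L)
    \<and> sheaf_on_KL F \<in> Cell (KL L) A
    \<and> bij_betw (\<lambda>v. kclass (hypergraph_of L) 0 (Inr v) [v]) (vertices L) (FObj (KL L) 0)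
    \<and> linear_order_on (FObj (KL L) 0) (KL_order L r)
    \<and> (\<exists>K. is_sheaf_cochains A L r F K)
    \<and> (\<exists>b :: nat \<Rightarrow> 'v set \<Rightarrow> (('v set + 'v) \<times> 'v list) set list.
      (\<forall>k. \<forall>s \<in> simplices L k. \<forall>x \<in> hcells (hypergraph_of L).
         s \<subseteq> cell_verts (hypergraph_of L) x \<longrightarrow>
         b k s = vertex_tuple (KL L) k (kclass (hypergraph_of L) k x (listing r s))) \<and>
      (\<forall>k. bij_betw (b k) (simplices L k) (increasing_tuples (KL L) (KL_order L r) k)) \<and>
      (\<forall>K. is_sheaf_cochains A L r F K \<longrightarrow>
         is_ordered_cochains A (KL L) (KL_order L r) (sheaf_on_KL F)
           (relabel (\<lambda>k. the_inv_into (simplices L k) (b k)) K)) \<and>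
      (\<forall>K. is_ordered_cochains A (KL L) (KL_order L r) (sheaf_on_KL F) K \<longrightarrow>
         is_sheaf_cochains A L r F (relabel b K)))"
proof -
  interpret ordered_simplicial_complex L r by unfold_locales (use assms in auto)
  interpret A: abelian_category A by (rule assms(1))
  have A: "preadditive_category A" ..
  have "is_ordered_cochains A (KL L) (KL_order L r) (sheaf_on_KL F)
      (relabel (\<lambda>k. the_inv_into (simplices L k) ordered_tuple) K)"
    if "is_sheaf_cochains A L r F K" for K
    by (rule iffD1[OF sheaf_cochains_iff_ordered_cochains[OF A assms(4)] that])
      (simp_all add: relabel_def the_inv_into_f_f[OF bij_betw_imp_inj_on[OF bij_betw_ordered_tuple]])
  moreover have "is_sheaf_cochains A L r F (relabel (\<lambda>k. ordered_tuple) K)"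
    if "is_ordered_cochains A (KL L) (KL_order L r) (sheaf_on_KL F) K" for K
    by (rule iffD2[OF sheaf_cochains_iff_ordered_cochains[OF A assms(4)] that]) (simp_all add: relabel_def)
  ultimately have "\<exists>b :: nat \<Rightarrow> 'v set \<Rightarrow> (('v set + 'v) \<times> 'v list) set list.
      (\<forall>k. \<forall>s \<in> simplices L k. \<forall>x \<in> hcells (hypergraph_of L).
         s \<subseteq> cell_verts (hypergraph_of L) x \<longrightarrow>
         b k s = vertex_tuple (KL L) k (kclass (hypergraph_of L) k x (listing r s))) \<and>
      (\<forall>k. bij_betw (b k) (simplices L k) (increasing_tuples (KL L) (KL_order L r) k)) \<and>
      (\<forall>K. is_sheaf_cochains A L r F K \<longrightarrow>
         is_ordered_cochains A (KL L) (KL_order L r) (sheaf_on_KL F)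
           (relabel (\<lambda>k. the_inv_into (simplices L k) (b k)) K)) \<and>
      (\<forall>K. is_ordered_cochains A (KL L) (KL_order L r) (sheaf_on_KL F) K \<longrightarrow>
         is_sheaf_cochains A L r F (relabel b K))"
    using bij_betw_ordered_tuple
    by (intro exI[of _ "\<lambda>k. ordered_tuple"] conjI allI ballI impI) (rule ordered_tuple_eq, blast+)
  then show ?thesis
    using is_hypergraph_of is_cech_KL sheaf_on_KL_in_Cell[OF assms(4)] bij_betw_vertices
      linear_order_on_KL ex_sheaf_cochains[OF assms(1,4)] by blast
qed

end
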